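(* Let $t>0$. As $a\downarrow 0$, the function $$a\mapsto\frac{\exp(2/a)}{a}\,\Pr\{A_t^{(1/2)}\le a\},\qquad a>0,$$ increases (that is, it is a decreasing function of $a\in(0,\infty)$).
   Context: $(B_t)_{t\ge 0}$ is a standard one-dimensional Brownian motion started at $0$, and $A_t^{(1/2)}=\int_0^t\exp(B_s)\,ds$. *)

theory Defs
  imports "HOL-Probability.Probability"
begin

text \<open>
  Time is indexed by \<open>real\<close>; only times \<open>t \<ge> 0\<close> are constrained. All sample paths
  over \<open>space M\<close> are continuous (not merely almost all), so that path functionals such as the
  integral below are measurable without completing \<open>M\<close>. Note that the second parameter of
  \<^const>\<open>normal_density\<close> is the standard deviation.
\<close>

locale std_brownian_motion = prob_space M
  for M :: "'a measure" and B :: "real \<Rightarrow> 'a \<Rightarrow> real" +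
  assumes random_variable_at: "\<And>t. 0 \<le> t \<Longrightarrow> random_variable borel (B t)"
    and starts_at_0: "AE \<omega> in M. B 0 \<omega> = 0"
    and indep_increments:
      "\<And>(\<tau> :: nat \<Rightarrow> real) n. 0 \<le> \<tau> 0 \<Longrightarrow> mono \<tau> \<Longrightarrow>
         indep_vars (\<lambda>_. borel) (\<lambda>i \<omega>. B (\<tau> (Suc i)) \<omega> - B (\<tau> i) \<omega>) {..<n}"
    and gaussian_increments:
      "\<And>s t. 0 \<le> s \<Longrightarrow> s < t \<Longrightarrow>
         distributed M lborel (\<lambda>\<omega>. B t \<omega> - B s \<omega>) (normal_density 0 (sqrt (t - s)))"
    and continuous_paths:
      "\<And>\<omega>. \<omega> \<in> space M \<Longrightarrow> continuous_on {0..} (\<lambda>t. B t \<omega>)"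

definition exp_functional :: "(real \<Rightarrow> 'a \<Rightarrow> real) \<Rightarrow> real \<Rightarrow> 'a \<Rightarrow> real" where
  "exp_functional B t \<omega> = integral {0..t} (\<lambda>s. exp (B s \<omega>))"

end

theory Submission
  imports Defs
begin

text \<open>
  Write \<open>F a\<close> for the distribution function of the functional and \<open>h a = exp (2 / a) / a * F a\<close>. It suffices
  that \<open>h\<close> is convex on \<open>{0<..}\<close>: since \<open>h\<close> tends to \<open>0\<close> at infinity and is positive far out, it is
  then strictly decreasing.

  The functional is the limit in law of the Markov chain \<open>A \<mapsto> exp X * (A + \<delta>)\<close> started at \<open>0\<close>, run for
  \<open>t / \<delta>\<close> steps with independent \<open>X\<close>, normal with variance \<open>\<delta>\<close>. As \<open>x \<mapsto> ln (c + d * exp x)\<close> has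
  derivatives bounded uniformly in \<open>c\<close> and \<open>d\<close>, Lindeberg's replacement argument allows any other
  law of \<open>X\<close> with mean \<open>0\<close>, nearly variance \<open>\<delta>\<close> and a small fourth moment. Take \<open>X = ln (U / (1 - U))\<close>
  with \<open>U\<close> distributed as Beta \<open>(p, p)\<close> and \<open>p = 2 / \<delta>\<close>. For this law,
  \<open>\<phi> a = a powr p * (a + \<delta>) powr (1 - p)\<close> is an eigenfunction of the chain's one-step operator, and
  conjugating by \<open>\<phi>\<close> turns the operator, up to a constant factor, into averaging of \<open>a \<mapsto> k ((a + \<delta>) * V)\<close> over a positive random
  variable \<open>V\<close>, which preserves convexity of \<open>k\<close>. Hence \<open>F\<^sub>n / \<phi>\<close> is convex for every \<open>n\<close>, where \<open>F\<^sub>n\<close> is the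
  distribution function after \<open>n\<close> steps. As \<open>\<delta>\<close> tends to \<open>0\<close>, \<open>\<phi> a\<close> tends to \<open>a * exp (- 2 / a)\<close>.
\<close>

section \<open>The logistic transform of the symmetric Beta law\<close>

lemma Beta_pos: "a > 0 \<Longrightarrow> b > 0 \<Longrightarrow> Beta a b > (0 :: real)"
  by (simp add: Beta_def)

lemma has_bochner_integral_Beta:
  fixes a b :: real
  assumes "a > 0" "b > 0"
  shows "has_bochner_integral lborel
           (\<lambda>u. indicator {0<..<1} u * (u powr (a - 1) * (1 - u) powr (b - 1))) (Beta a b)"
proof (rule has_bochner_integral_nn_integral)
  have "((\<lambda>u. u powr (a - 1) * (1 - u) powr (b - 1)) has_integral Beta a b) {0<..<1}"
    using has_integral_Beta_real[OF assms] by (simp add: has_integral_Icc_iff_Ioo)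
  from nn_integral_has_integral_lebesgue[OF _ this]
  show "(\<integral>\<^sup>+u. ennreal (indicator {0<..<1} u * (u powr (a - 1) * (1 - u) powr (b - 1))) \<partial>lborel)
      = ennreal (Beta a b)"
    by simp
  show "0 \<le> Beta a b"
    using assms by (simp add: Beta_def)
qed (auto intro!: AE_I2)

definition beta_density :: "real \<Rightarrow> real \<Rightarrow> real" where
  "beta_density p u =
     indicator {0<..<1} u * (u powr (p - 1) * (1 - u) powr (p - 1)) / Beta p p"

text \<open>This is the symmetric generalised logistic law, with density proportional to
  \<open>(exp (x / 2) + exp (- x / 2)) powr (- 2 * p)\<close>. Keeping it as an image of the Beta
  law turns later integrals into integrals over \<open>u\<close> against
  \<open>beta_density\<close>.\<close>

definition logit_beta :: "real \<Rightarrow> real measure" where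
  "logit_beta p = distr (density lborel (beta_density p)) borel (\<lambda>u. ln (u / (1 - u)))"

lemma beta_density_nonneg: "p > 0 \<Longrightarrow> beta_density p u \<ge> 0"
  using Beta_pos[of p p] by (simp add: beta_density_def)

lemma borel_measurable_beta_density [measurable]: "beta_density p \<in> borel_measurable borel"
  unfolding beta_density_def[abs_def] by measurable

lemma sets_logit_beta [measurable_cong, simp]: "sets (logit_beta p) = sets borel"
  by (simp add: logit_beta_def)

lemma space_logit_beta [simp]: "space (logit_beta p) = UNIV"
  by (simp add: logit_beta_def)

lemma prob_space_logit_beta:
  assumes "p > 0" shows "prob_space (logit_beta p)"
proof -
  have "(\<integral>\<^sup>+u. ennreal (beta_density p u) \<partial>lborel) = ennreal (Beta p p / Beta p p)"
    using has_bochner_integral_divide[OF has_bochner_integral_Beta[OF assms assms], of "Beta p p"]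
      beta_density_nonneg[OF assms] Beta_pos[OF assms assms]
    by (intro nn_integral_eq_integral[THEN trans])
       (auto simp: has_bochner_integral_iff beta_density_def[abs_def])
  then have "prob_space (density lborel (beta_density p))"
    using Beta_pos[OF assms assms]
    by (intro prob_spaceI) (simp add: emeasure_density)
  then show ?thesis
    unfolding logit_beta_def by (rule prob_space.prob_space_distr) measurable
qed

text \<open>Applied at \<open>p\<close>, \<open>p - 1\<close> and \<open>p - 2\<close>, this
  recursion yields the ratios \<open>Beta (p + i) (p + i) / Beta p p\<close> for
  \<open>i = 1, -1, -2\<close>, from which the moment bounds are built.\<close>

lemma Beta_plus1_diagonal:
  fixes p :: real
  assumes "p > 0"
  shows "Beta (p + 1) (p + 1) = p / (2 * (2 * p + 1)) * Beta p p"
proof -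
  have n: "p \<notin> \<int>\<^sub>\<le>\<^sub>0" using assms by (auto elim!: nonpos_Ints_cases)
  have 1: "(2 * p + 1) * Beta (p + 1) (p + 1) = p * Beta p (p + 1)"
    using Beta_plus1_left[OF n, of "p + 1"] by (simp add: algebra_simps)
  have 2: "2 * Beta p (p + 1) = Beta p p"
    using Beta_plus1_right[OF n, of p] assms by simp
  have "2 * (2 * p + 1) * Beta (p + 1) (p + 1) = p * Beta p p"
    using 1 2 by algebra
  then show ?thesis using assms by (simp add: field_simps)
qed

text \<open>A power of \<open>u * (1 - u)\<close> only shifts both Beta parameters; the exponent may
  be negative as long as \<open>p + i\<close> stays positive.\<close>

lemma beta_density_moment:
  assumes "p > 0" "p + i > 0"
  shows "has_bochner_integral lborel (\<lambda>u. beta_density p u * (u * (1 - u)) powr i)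
           (Beta (p + i) (p + i) / Beta p p)"
proof -
  have "indicator {0<..<1} u * (u powr (p + i - 1) * (1 - u) powr (p + i - 1)) / Beta p p
      = beta_density p u * (u * (1 - u)) powr i" for u
  proof (cases "u \<in> {0<..<1}")
    case True
    have "z powr (p + i - 1) = z powr (p - 1) * z powr i" for z :: real
      by (simp add: powr_add[symmetric] algebra_simps)
    with True show ?thesis by (simp add: beta_density_def powr_mult mult_ac)
  qed (simp add: beta_density_def)
  then show ?thesis
    using has_bochner_integral_divide[OF has_bochner_integral_Beta[OF assms(2,2)], of "Beta p p"]
      Beta_pos[OF assms(1,1)] by simp
qed

text \<open>With \<open>y = x / 2\<close> one has \<open>tanh y = 2 * u - 1\<close> and
  \<open>sinh y ^ 2 = (2 * u - 1)\<^sup>2 / (4 * (u * (1 - u)))\<close>, so both bounds come from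
  |tanh y| \<le> |y| \<le> |sinh y|. They trade the logarithm for rational functions of
  \<open>u\<close>.\<close>

lemma logit_bounds:
  fixes u :: real
  assumes "0 < u" "u < 1"
  defines "x \<equiv> ln (u / (1 - u))"
  shows "4 * (2 * u - 1)\<^sup>2 \<le> x\<^sup>2" "x\<^sup>2 \<le> (2 * u - 1)\<^sup>2 / (u * (1 - u))"
proof -
  define y where "y = x / 2"
  have e: "exp y ^ 2 = u / (1 - u)"
    using assms unfolding y_def x_def by (simp add: exp_double[symmetric])
  have t: "tanh y = 2 * u - 1"
  proof -
    have "tanh y = (exp y ^ 2 - 1) / (exp y ^ 2 + 1)"
    proof -
      have "tanh y = (exp y - 1 / exp y) / (exp y + 1 / exp y)"
        by (simp add: tanh_altdef exp_minus inverse_eq_divide)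
      also have "\<dots> = ((exp y - 1 / exp y) * exp y) / ((exp y + 1 / exp y) * exp y)"
        by simp
      finally show ?thesis by (simp add: algebra_simps power2_eq_square)
    qed
    also have "\<dots> = 2 * u - 1" unfolding e using assms by (simp add: field_simps)
    finally show ?thesis .
  qed
  have s: "sinh y ^ 2 = (2 * u - 1)\<^sup>2 / (4 * (u * (1 - u)))"
  proof -
    have "sinh y ^ 2 = (exp y ^ 2 - 1)\<^sup>2 / (4 * exp y ^ 2)"
      by (simp add: sinh_field_def power2_eq_square exp_minus field_simps)
    also have "\<dots> = (2 * u - 1)\<^sup>2 / (4 * (u * (1 - u)))"
    proof -
      have "u / (1 - u) - 1 = (2 * u - 1) / (1 - u)" using assms by (simp add: field_simps)
      then have "(exp y ^ 2 - 1)\<^sup>2 / (4 * exp y ^ 2) = ((2 * u - 1) / (1 - u))\<^sup>2 / (4 * (u / (1 - u)))"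
        unfolding e by simp
      also have "\<dots> = (2 * u - 1)\<^sup>2 / (4 * (u * (1 - u)))"
        using assms by (simp add: power_divide power2_eq_square)
      finally show ?thesis .
    qed
    finally show ?thesis .
  qed
  have ty: "\<bar>tanh z\<bar> \<le> \<bar>z\<bar>" for z :: real
  proof -
    have *: "tanh z \<le> z" if "z \<ge> 0" for z :: real
    proof -
      have "0 - tanh 0 \<le> z - tanh z"
        by (rule DERIV_nonneg_imp_nondecreasing[OF that])
           (auto intro!: exI derivative_eq_intros simp: cosh_real_nonzero)
      then show ?thesis by simp
    qed
    show ?thesis using *[of z] *[of "-z"] by (cases "z \<ge> 0") (auto simp: tanh_real_abs[symmetric] simp del: tanh_real_abs)
  qed
  have sy: "\<bar>y\<bar> \<le> \<bar>sinh y\<bar>"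
    using real_le_abs_sinh[of y] by (simp add: sinh_field_def exp_minus)
  have "(2 * u - 1)\<^sup>2 \<le> (x / 2)\<^sup>2" using ty[of y] unfolding t unfolding y_def by (simp only: abs_le_square_iff)
  then show "4 * (2 * u - 1)\<^sup>2 \<le> x\<^sup>2" by (simp add: power_divide)
  have "y\<^sup>2 \<le> (sinh y)\<^sup>2" using sy by (simp add: abs_le_square_iff)
  then show "x\<^sup>2 \<le> (2 * u - 1)\<^sup>2 / (u * (1 - u))" unfolding s unfolding y_def by (simp add: power_divide)
qed


text \<open>As \<open>(2 * u - 1)\<^sup>2 = 1 - 4 * (u * (1 - u))\<close>, the bounds of
  \<open>logit_bounds\<close> and the square of the upper one are combinations of powers of
  \<open>u * (1 - u)\<close> with exponents 1, 0, -1 and -2, whose Beta moments are explicit. The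
  exponent -2 calls for \<open>p > 2\<close>.\<close>

lemma logit_beta_moments:
  fixes p :: real
  assumes p: "p > 2"
  defines "M \<equiv> logit_beta p"
  shows "integral\<^sup>L M (\<lambda>x. x) = 0"
    and "integrable M (\<lambda>x. x ^ 2)"
    and "4 / (2 * p + 1) \<le> (LINT x|M. x ^ 2)" and "(LINT x|M. x ^ 2) \<le> 2 / (p - 1)"
    and "integrable M (\<lambda>x. x ^ 4)" and "(LINT x|M. x ^ 4) \<le> 12 / ((p - 1) * (p - 2))"
proof -
  let ?w = "beta_density p" and ?l = "\<lambda>u::real. ln (u / (1 - u))"
  let ?r = "\<lambda>i. Beta (p + i) (p + i) / Beta p p"
  have B: "Beta q q > 0" if "q > 0" for q :: real using Beta_pos that by simp
  have int: "integrable M f \<longleftrightarrow> integrable lborel (\<lambda>u. ?w u * f (?l u))"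
            "integral\<^sup>L M f = (LINT u|lborel. ?w u * f (?l u))"
    if "f \<in> borel_measurable borel" for f :: "real \<Rightarrow> real"
    using that p beta_density_nonneg[of p] unfolding M_def logit_beta_def
    by (simp_all add: integrable_distr_eq integral_distr integrable_density integral_density)
  have w0: "?w u = 0" if "u \<notin> {0<..<1}" for u
    using that by (auto simp: beta_density_def indicator_def)
  have wn: "?w u \<ge> 0" for u using beta_density_nonneg p by simp
  have m0: "has_bochner_integral lborel ?w 1"
  proof -
    have "has_bochner_integral lborel (\<lambda>u. ?w u * (u * (1 - u)) powr 0) 1"
      using beta_density_moment[of p 0] p B[of p] by simp
    \<comment> \<open>Since \<open>0 powr 0\<close> is \<open>0\<close>, the equality at
      \<open>u = 0\<close> and \<open>u = 1\<close> rests on the weight vanishing there.\<close>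
    moreover have "(\<lambda>u. ?w u * (u * (1 - u)) powr 0) = ?w"
    proof
      fix u show "?w u * (u * (1 - u)) powr 0 = ?w u"
        by (cases "u \<in> {0<..<1}") (auto simp: w0)
    qed
    ultimately show ?thesis by (simp only:)
  qed
  have r1: "?r 1 = p / (2 * (2 * p + 1))"
    using Beta_plus1_diagonal[of p] B[of p] p by (simp add: field_simps)
  have rm1: "?r (-1) = 2 * (2 * p - 1) / (p - 1)"
    using Beta_plus1_diagonal[of "p - 1"] B[of p] B[of "p - 1"] p by (simp add: field_simps)
  have rm2: "?r (-2) = 4 * (2 * p - 1) * (2 * p - 3) / ((p - 1) * (p - 2))"
  proof -
    have "Beta (p - 1) (p - 1) = (p - 2) / (2 * (2 * (p - 2) + 1)) * Beta (p - 2) (p - 2)"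
      using Beta_plus1_diagonal[of "p - 2"] p by (simp add: algebra_simps)
    moreover have "Beta (p - 1) (p - 1) = 2 * (2 * p - 1) / (p - 1) * Beta p p"
      using rm1 B[of p] p by (simp add: field_simps)
    ultimately have "(p - 2) / (2 * (2 * (p - 2) + 1)) * Beta (p - 2) (p - 2) = 2 * (2 * p - 1) / (p - 1) * Beta p p"
      by simp
    then have "Beta (p - 2) (p - 2) = 2 * (2 * p - 1) / (p - 1) * Beta p p * (2 * (2 * (p - 2) + 1) / (p - 2))"
      using p by (simp add: divide_simps mult_ac)
    also have "\<dots> / Beta p p = 4 * (2 * p - 1) * (2 * p - 3) / ((p - 1) * (p - 2))"
      using B[of p] p by simp (simp add: algebra_simps)
    finally show ?thesis by simp
  qed
  have m: "has_bochner_integral lborel (\<lambda>u. ?w u * (u * (1 - u)) powr i) (?r i)" if "p + i > 0" for i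
    using beta_density_moment[of p i] that p by simp

  have L2: "has_bochner_integral lborel (\<lambda>u. ?w u * (4 * (2 * u - 1)\<^sup>2)) (4 / (2 * p + 1))"
  proof -
    have "has_bochner_integral lborel (\<lambda>u. 4 * (?w u - 4 * (?w u * (u * (1 - u)) powr 1))) (4 * (1 - 4 * ?r 1))"
      using p by (intro has_bochner_integral_diff has_bochner_integral_mult_right m0 m) auto
    also have "(\<lambda>u. 4 * (?w u - 4 * (?w u * (u * (1 - u)) powr 1))) = (\<lambda>u. ?w u * (4 * (2 * u - 1)\<^sup>2))"
    proof
      fix u show "4 * (?w u - 4 * (?w u * (u * (1 - u)) powr 1)) = ?w u * (4 * (2 * u - 1)\<^sup>2)"
        using w0[of u] by (cases "u \<in> {0<..<1}") (auto simp: algebra_simps power2_eq_square)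
    qed
    also have "4 * (1 - 4 * ?r 1) = 4 / (2 * p + 1)"
      using p unfolding r1 by (simp add: field_simps)
    finally show ?thesis .
  qed
  have U2: "has_bochner_integral lborel (\<lambda>u. ?w u * ((2 * u - 1)\<^sup>2 / (u * (1 - u)))) (2 / (p - 1))"
  proof -
    have "has_bochner_integral lborel (\<lambda>u. ?w u * (u * (1 - u)) powr (-1) - 4 * ?w u) (?r (-1) - 4 * 1)"
      using p by (intro has_bochner_integral_diff has_bochner_integral_mult_right m0 m) auto
    also have "(\<lambda>u. ?w u * (u * (1 - u)) powr (-1) - 4 * ?w u) = (\<lambda>u. ?w u * ((2 * u - 1)\<^sup>2 / (u * (1 - u))))"
    proof
      fix u show "?w u * (u * (1 - u)) powr (-1) - 4 * ?w u = ?w u * ((2 * u - 1)\<^sup>2 / (u * (1 - u)))"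
        using w0[of u]
        by (cases "u \<in> {0<..<1}") (auto simp: powr_minus field_simps power2_eq_square)
    qed
    also have "?r (-1) - 4 * 1 = 2 / (p - 1)"
      using p unfolding rm1 by (simp add: field_simps)
    finally show ?thesis .
  qed
  have U4: "has_bochner_integral lborel (\<lambda>u. ?w u * ((2 * u - 1)\<^sup>2 / (u * (1 - u)))\<^sup>2) (12 / ((p - 1) * (p - 2)))"
  proof -
    have "has_bochner_integral lborel (\<lambda>u. ?w u * (u * (1 - u)) powr (-2) - 8 * (?w u * (u * (1 - u)) powr (-1)) + 16 * ?w u)
       (?r (-2) - 8 * ?r (-1) + 16 * 1)"
      using p by (intro has_bochner_integral_diff has_bochner_integral_add has_bochner_integral_mult_right m0 m) auto
    also have "(\<lambda>u. ?w u * (u * (1 - u)) powr (-2) - 8 * (?w u * (u * (1 - u)) powr (-1)) + 16 * ?w u)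
        = (\<lambda>u. ?w u * ((2 * u - 1)\<^sup>2 / (u * (1 - u)))\<^sup>2)"
    proof
      fix u show "?w u * (u * (1 - u)) powr (-2) - 8 * (?w u * (u * (1 - u)) powr (-1)) + 16 * ?w u
          = ?w u * ((2 * u - 1)\<^sup>2 / (u * (1 - u)))\<^sup>2"
      proof (cases "u \<in> {0<..<1}")
        case True
        define v where "v = u * (1 - u)"
        have v: "v > 0" "(2 * u - 1)\<^sup>2 = 1 - 4 * v"
          using True by (auto simp: v_def algebra_simps power2_eq_square)
        have "v powr (-2) = 1 / v ^ 2" "v powr (-1) = 1 / v"
          using v by (simp_all add: powr_minus inverse_eq_divide)
        then show ?thesis unfolding v_def[symmetric] v using v(1)
          by (simp add: field_simps power2_eq_square)
      qed (simp add: w0)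
    qed
    also have "?r (-2) - 8 * ?r (-1) + 16 * 1 = 12 / ((p - 1) * (p - 2))"
    proof -
      have "(p - 1) * (p - 2) \<noteq> 0" "p - 1 \<noteq> 0" using p by auto
      then show ?thesis unfolding rm1 rm2 by (simp add: divide_simps) (simp add: algebra_simps)
    qed
    finally show ?thesis .
  qed
  have le2: "?w u * (?l u)\<^sup>2 \<le> ?w u * ((2 * u - 1)\<^sup>2 / (u * (1 - u)))" for u
    using logit_bounds(2)[of u] w0[of u] mult_left_mono[OF _ wn[of u]]
    by (cases "u \<in> {0<..<1}") (simp_all only: greaterThanLessThan_iff mult_zero_left order_refl not_False_eq_True simp_thms)
  have ge2: "?w u * (4 * (2 * u - 1)\<^sup>2) \<le> ?w u * (?l u)\<^sup>2" for u
    using logit_bounds(1)[of u] w0[of u] mult_left_mono[OF _ wn[of u]]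
    by (cases "u \<in> {0<..<1}") (simp_all only: greaterThanLessThan_iff mult_zero_left order_refl not_False_eq_True simp_thms)
  have le4: "?w u * (?l u) ^ 4 \<le> ?w u * ((2 * u - 1)\<^sup>2 / (u * (1 - u)))\<^sup>2" for u
  proof (cases "u \<in> {0<..<1}")
    case True
    have "((?l u)\<^sup>2)\<^sup>2 \<le> ((2 * u - 1)\<^sup>2 / (u * (1 - u)))\<^sup>2"
      using logit_bounds(2)[of u] True by (intro power_mono) auto
    then show ?thesis using wn[of u] by (intro mult_left_mono) (simp_all add: power_mult[symmetric])
  qed (simp add: w0)
  have dom: "integrable lborel f" if "integrable lborel g" "f \<in> borel_measurable borel"
    "\<And>u. 0 \<le> f u" "\<And>u. f u \<le> g u" for f g :: "real \<Rightarrow> real"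
  proof (rule Bochner_Integration.integrable_bound[OF that(1)])
    show "AE u in lborel. norm (f u) \<le> norm (g u)"
      using that(3,4) by (intro AE_I2) (simp add: order_trans[OF _ abs_ge_self])
  qed (use that in simp)
  have i2: "integrable lborel (\<lambda>u. ?w u * (?l u)\<^sup>2)"
    by (rule dom[OF integrable.intros[OF U2] _ _ le2]) (use wn in auto)
  have i4: "integrable lborel (\<lambda>u. ?w u * (?l u) ^ 4)"
    by (rule dom[OF integrable.intros[OF U4] _ _ le4]) (use wn in auto)
  show "integrable M (\<lambda>x. x ^ 2)" "integrable M (\<lambda>x. x ^ 4)" using i2 i4 by (simp_all add: int)
  show "(LINT x|M. x ^ 2) \<le> 2 / (p - 1)"
    using integral_mono[OF i2 integrable.intros[OF U2] le2] has_bochner_integral_integral_eq[OF U2] by (simp add: int)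
  show "4 / (2 * p + 1) \<le> (LINT x|M. x ^ 2)"
    using integral_mono[OF integrable.intros[OF L2] i2 ge2] has_bochner_integral_integral_eq[OF L2] by (simp add: int)
  show "(LINT x|M. x ^ 4) \<le> 12 / ((p - 1) * (p - 2))"
    using integral_mono[OF i4 integrable.intros[OF U4] le4] has_bochner_integral_integral_eq[OF U4] by (simp add: int)
  \<comment> \<open>The reflection \<open>u\<close> to \<open>1 - u\<close> preserves the weight and
    flips the sign of the logit, so the mean equals its own negative.\<close>
  have "(LINT u|lborel. ?w u * ?l u) = (LINT u|lborel. ?w (1 + (-1) * u) * ?l (1 + (-1) * u))"
    using lborel_integral_real_affine[of "-1" "\<lambda>u. ?w u * ?l u" 1] by simp
  also have "\<dots> = (LINT u|lborel. - (?w u * ?l u))"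
  proof (intro Bochner_Integration.integral_cong refl)
    fix u :: real
    show "?w (1 + (-1) * u) * ?l (1 + (-1) * u) = - (?w u * ?l u)"
      by (cases "u \<in> {0<..<1}") (auto simp: w0 beta_density_def ln_div algebra_simps minus_divide_left)
  qed
  finally have "(LINT u|lborel. ?w u * ?l u) = 0" by simp
  then show "integral\<^sup>L M (\<lambda>x. x) = 0" by (simp add: int)
qed

section \<open>Lindeberg replacement for the multiplicative chain\<close>

text \<open>The logarithmic derivative \<open>s = d * exp x / (c + d * exp x)\<close> lies in [0, 1]
  and satisfies \<open>s' = s * (1 - s)\<close>. All derivatives are therefore polynomials in
  \<open>s\<close> times a sine or cosine, bounded independently of \<open>c\<close> and
  \<open>d\<close>. No bound on \<open>b1\<close> is asked for, as the linear term will be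
  integrated against a law of mean zero.\<close>

lemma cos_ln_affine_exp_Taylor:
  fixes \<theta> \<eta> c d :: real
  assumes "c \<ge> 0" "d > 0"
  defines "u \<equiv> \<lambda>x. cos (\<theta> * ln (c + d * exp x) + \<eta>)"
  obtains b1 b2 :: real
  where "\<bar>b2\<bar> \<le> \<bar>\<theta>\<bar> + \<theta>\<^sup>2"
    and "\<And>x. \<bar>u x - (u 0 + b1 * x + b2 / 2 * x ^ 2)\<bar> \<le> (\<bar>\<theta>\<bar> + 3 * \<theta>\<^sup>2 + \<bar>\<theta>\<bar> ^ 3) * \<bar>x\<bar> ^ 3"
proof -
  define g where "g x = c + d * exp x" for x :: real
  have g: "g x > 0" for x using assms by (simp add: g_def add_nonneg_pos)
  define s where "s x = d * exp x / g x" for x :: real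
  have s01: "0 \<le> s x" "s x \<le> 1" for x using g[of x] assms by (auto simp: s_def g_def)
  have Ds [derivative_intros]: "(s has_field_derivative D) (at x)" if "D = s x * (1 - s x)" for x D
    unfolding s_def[abs_def] g_def that
    using g[of x] by (auto intro!: derivative_eq_intros simp: g_def field_simps)
  define L where "L x = \<theta> * ln (g x) + \<eta>" for x
  have DL [derivative_intros]: "(L has_field_derivative D) (at x)" if "D = \<theta> * s x" for x D
    unfolding L_def g_def that
    using g[of x] by (auto intro!: derivative_eq_intros simp: g_def s_def field_simps)
  have Dcos: "((\<lambda>x. cos (L x)) has_field_derivative (- sin (L x) * (\<theta> * s x))) (at x)"
    and Dsin: "((\<lambda>x. sin (L x)) has_field_derivative (cos (L x) * (\<theta> * s x))) (at x)" for x
    by (auto intro!: derivative_eq_intros)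
  define f :: "nat \<Rightarrow> real \<Rightarrow> real" where
    "f i x = (if i = 0 then cos (L x)
       else if i = 1 then - \<theta> * s x * sin (L x)
       else if i = 2 then - \<theta> * (s x * (1 - s x)) * sin (L x) - \<theta>\<^sup>2 * (s x)\<^sup>2 * cos (L x)
       else - \<theta> * (s x * (1 - s x) * (1 - 2 * s x)) * sin (L x)
         - 3 * \<theta>\<^sup>2 * ((s x)\<^sup>2 * (1 - s x)) * cos (L x) + \<theta> ^ 3 * (s x) ^ 3 * sin (L x))" for i x
  have D: "(f i has_field_derivative f (Suc i) x) (at x within UNIV)" if i: "i \<le> 2" for i x
  proof -
    consider "i = 0" | "i = 1" | "i = 2" using i by linarith
    then show ?thesis
    proof cases
      case 1
      then show ?thesis using Dcos[of x] by (simp add: f_def[abs_def] mult_ac)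
    next
      case 2
      have "((\<lambda>x. - \<theta> * s x * sin (L x)) has_field_derivative
         - \<theta> * (s x * (1 - s x)) * sin (L x) - \<theta>\<^sup>2 * (s x)\<^sup>2 * cos (L x)) (at x)"
        by (rule derivative_eq_intros Dsin refl)+ (simp add: algebra_simps power2_eq_square)
      then show ?thesis using 2 by (simp add: f_def[abs_def])
    next
      case 3
      have "((\<lambda>x. - \<theta> * (s x * (1 - s x)) * sin (L x) - \<theta>\<^sup>2 * (s x)\<^sup>2 * cos (L x)) has_field_derivative
          - \<theta> * (s x * (1 - s x) * (1 - 2 * s x)) * sin (L x)
         - 3 * \<theta>\<^sup>2 * ((s x)\<^sup>2 * (1 - s x)) * cos (L x) + \<theta> ^ 3 * (s x) ^ 3 * sin (L x)) (at x)"
        by (rule derivative_eq_intros Dsin Dcos refl)+ (simp add: algebra_simps power2_eq_square power3_eq_cube)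
      then show ?thesis using 3 by (simp add: f_def[abs_def])
    qed
  qed
  have sc: "\<bar>a * b\<bar> \<le> \<bar>a\<bar>" if "\<bar>b\<bar> \<le> 1" for a b :: real
    using mult_left_mono[OF that, of "\<bar>a\<bar>"] by (simp add: abs_mult)
  have s1: "\<bar>1 - s x\<bar> \<le> 1" "\<bar>1 - 2 * s x\<bar> \<le> 1" "\<bar>s x\<bar> \<le> 1" for x
    using s01[of x] by auto
  have s2: "\<bar>s x ^ k\<bar> \<le> 1" for x k
    using s01[of x] by (simp add: power_le_one)
  have s3: "\<bar>a * b\<bar> \<le> 1" if "\<bar>a\<bar> \<le> 1" "\<bar>b\<bar> \<le> 1" for a b :: real
    using that by (simp add: abs_mult mult_le_one)
  have B: "\<bar>f (Suc 2) x\<bar> \<le> \<bar>\<theta>\<bar> + 3 * \<theta>\<^sup>2 + \<bar>\<theta>\<bar> ^ 3" for x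
  proof -
    have "\<bar>- \<theta> * (s x * (1 - s x) * (1 - 2 * s x) * sin (L x))\<bar> \<le> \<bar>- \<theta>\<bar>"
      by (intro sc s3 s1 abs_sin_le_one)
    moreover have "\<bar>(3 * \<theta>\<^sup>2) * ((s x)\<^sup>2 * (1 - s x) * cos (L x))\<bar> \<le> \<bar>3 * \<theta>\<^sup>2\<bar>"
      by (intro sc s3 s1 s2 abs_cos_le_one)
    moreover have "\<bar>\<theta> ^ 3 * ((s x) ^ 3 * sin (L x))\<bar> \<le> \<bar>\<theta> ^ 3\<bar>"
      by (intro sc s3 s1 s2 abs_sin_le_one)
    moreover have "f (Suc 2) x = - \<theta> * (s x * (1 - s x) * (1 - 2 * s x) * sin (L x))
        - (3 * \<theta>\<^sup>2) * ((s x)\<^sup>2 * (1 - s x) * cos (L x)) + \<theta> ^ 3 * ((s x) ^ 3 * sin (L x))"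
      by (simp add: f_def mult_ac)
    ultimately show ?thesis by (simp add: power_abs)
  qed
  have "\<bar>f 2 0\<bar> \<le> \<bar>\<theta>\<bar> + \<theta>\<^sup>2"
  proof -
    have "\<bar>- \<theta> * (s 0 * (1 - s 0) * sin (L 0))\<bar> \<le> \<bar>- \<theta>\<bar>"
      by (intro sc s3 s1 abs_sin_le_one)
    moreover have "\<bar>\<theta>\<^sup>2 * ((s 0)\<^sup>2 * cos (L 0))\<bar> \<le> \<bar>\<theta>\<^sup>2\<bar>"
      by (intro sc s3 s1 s2 abs_cos_le_one)
    moreover have "f 2 0 = - \<theta> * (s 0 * (1 - s 0) * sin (L 0)) - \<theta>\<^sup>2 * ((s 0)\<^sup>2 * cos (L 0))"
      by (simp add: f_def mult_ac)
    ultimately show ?thesis by simp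
  qed
  moreover have "\<bar>u x - (u 0 + f 1 0 * x + f 2 0 / 2 * x ^ 2)\<bar> \<le> (\<bar>\<theta>\<bar> + 3 * \<theta>\<^sup>2 + \<bar>\<theta>\<bar> ^ 3) * \<bar>x\<bar> ^ 3" for x
  proof -
    have "norm (f 0 x - (\<Sum>i\<le>2. f i 0 * (x - 0) ^ i / fact i))
        \<le> (\<bar>\<theta>\<bar> + 3 * \<theta>\<^sup>2 + \<bar>\<theta>\<bar> ^ 3) * norm (x - 0) ^ Suc 2 / fact 2"
      using D B by (intro field_Taylor[where S = UNIV]) auto
    also have "\<dots> \<le> (\<bar>\<theta>\<bar> + 3 * \<theta>\<^sup>2 + \<bar>\<theta>\<bar> ^ 3) * \<bar>x\<bar> ^ 3"
      by (simp add: numeral_3_eq_3[symmetric])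
    also have "(\<Sum>i\<le>2. f i 0 * (x - 0) ^ i / fact i) = u 0 + f 1 0 * x + f 2 0 / 2 * x ^ 2"
      by (simp add: numeral_2_eq_2 f_def u_def L_def g_def)
    finally show ?thesis by (simp add: f_def u_def L_def g_def)
  qed
  ultimately show ?thesis using that by blast
qed

text \<open>The tolerances are chosen for about \<open>t / \<delta>\<close> steps: a variance error
  of order \<open>\<delta>\<^sup>2\<close> per step adds up to order \<open>\<delta>\<close>, and a
  fourth moment of order \<open>\<delta>\<^sup>2\<close> controls the cubic Taylor
  remainder.\<close>

definition step_law :: "real \<Rightarrow> real \<Rightarrow> real measure \<Rightarrow> bool" where
  "step_law K \<delta> \<gamma> \<longleftrightarrow> prob_space \<gamma> \<and> sets \<gamma> = sets borel \<and> (LINT x|\<gamma>. x) = 0 \<and>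
     integrable \<gamma> (\<lambda>x. x ^ 2) \<and> \<bar>(LINT x|\<gamma>. x ^ 2) - \<delta>\<bar> \<le> K * \<delta>\<^sup>2 \<and>
     integrable \<gamma> (\<lambda>x. x ^ 4) \<and> (LINT x|\<gamma>. x ^ 4) \<le> K * \<delta>\<^sup>2"

text \<open>Integrating the Taylor polynomial removes the linear term and leaves
  \<open>u 0 + b2 / 2 * \<delta>\<close> up to the variance error. This value does not depend on the
  law, so any two step laws with the same \<open>\<delta>\<close> can be compared through
  it.\<close>

lemma step_law_cos_expectation:
  fixes \<delta> K b1 b2 C :: real and \<gamma> :: "real measure" and u :: "real \<Rightarrow> real"
  assumes \<gamma>: "step_law K \<delta> \<gamma>" and K: "K \<ge> 0" and \<delta>: "0 < \<delta>" "\<delta> \<le> 1"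
    and [measurable]: "u \<in> borel_measurable borel" and ub: "\<And>x. \<bar>u x\<bar> \<le> 1"
    and T: "\<And>x. \<bar>u x - (u 0 + b1 * x + b2 / 2 * x ^ 2)\<bar> \<le> C * \<bar>x\<bar> ^ 3"
    and b2: "\<bar>b2\<bar> \<le> C"
  shows "\<bar>(LINT x|\<gamma>. u x) - (u 0 + b2 / 2 * \<delta>)\<bar> \<le> C * (1 + 2 * K) * (\<delta> * sqrt \<delta>)"
proof -
  interpret prob_space \<gamma> using \<gamma> by (simp add: step_law_def)
  have [measurable_cong]: "sets \<gamma> = sets borel"
    and mean: "(LINT x|\<gamma>. x) = 0"
    and i2: "integrable \<gamma> (\<lambda>x. x ^ 2)" and v: "\<bar>(LINT x|\<gamma>. x ^ 2) - \<delta>\<bar> \<le> K * \<delta>\<^sup>2"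
    and i4: "integrable \<gamma> (\<lambda>x. x ^ 4)" and q: "(LINT x|\<gamma>. x ^ 4) \<le> K * \<delta>\<^sup>2"
    using \<gamma> by (auto simp: step_law_def)
  have C: "C \<ge> 0" using b2 by linarith
  have i1: "integrable \<gamma> (\<lambda>x. x)"
  proof (rule Bochner_Integration.integrable_bound)
    show "integrable \<gamma> (\<lambda>x. 1 + x ^ 2)" using i2 by simp
    have "\<bar>x\<bar> \<le> 1 + x ^ 2" for x :: real
      using zero_le_power2[of "\<bar>x\<bar> - 1"] by (simp add: power2_eq_square algebra_simps)
    then show "AE x in \<gamma>. norm x \<le> norm (1 + x ^ 2)" by (auto intro!: AE_I2)
  qed simp
  have iu: "integrable \<gamma> u" using ub by (intro integrable_const_bound[where B = 1]) auto
  have d: "\<delta> > 0" "sqrt \<delta> > 0" "sqrt \<delta> * sqrt \<delta> = \<delta>" using \<delta> by auto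
  have d2: "\<delta>\<^sup>2 \<le> \<delta> * sqrt \<delta>"
    using \<delta> real_sqrt_le_mono[of "\<delta> * \<delta>" \<delta>] by (simp add: power2_eq_square real_sqrt_mult mult_left_le)
  \<comment> \<open>The arithmetic-geometric mean inequality, weighted by
    \<open>sqrt \<delta>\<close> so that the second and the fourth moment both contribute at order
    \<open>\<delta> * sqrt \<delta>\<close>.\<close>
  have cube: "\<bar>x\<bar> ^ 3 \<le> (sqrt \<delta> * x ^ 2 + x ^ 4 / sqrt \<delta>) / 2" for x :: real
  proof -
    have "0 \<le> x ^ 2 * (sqrt \<delta> - \<bar>x\<bar>)\<^sup>2 / sqrt \<delta>" using d by simp
    also have "\<dots> = (sqrt \<delta> * x ^ 2 + x ^ 4 / sqrt \<delta>) - 2 * \<bar>x\<bar> ^ 3"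
      using d by (simp add: field_simps power2_eq_square power3_eq_cube power4_eq_xxxx abs_mult_self_eq)
    finally show ?thesis by simp
  qed
  have "(LINT x|\<gamma>. u x) - (u 0 + b2 / 2 * (LINT x|\<gamma>. x ^ 2)) = (LINT x|\<gamma>. u x - (u 0 + b1 * x + b2 / 2 * x ^ 2))"
    using i1 i2 iu mean by (simp add: prob_space)
  also have "\<bar>\<dots>\<bar> \<le> (LINT x|\<gamma>. C * ((sqrt \<delta> * x ^ 2 + x ^ 4 / sqrt \<delta>) / 2))"
    using i1 i2 iu i4
    by (intro integral_abs_bound[THEN order_trans] integral_mono order_trans[OF T] mult_left_mono cube C)
       auto
  also have "\<dots> = C * ((sqrt \<delta> * (LINT x|\<gamma>. x ^ 2) + (LINT x|\<gamma>. x ^ 4) / sqrt \<delta>) / 2)"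
    using i2 i4 by simp
  also have "\<dots> \<le> C * ((sqrt \<delta> * (\<delta> + K * \<delta>) + K * \<delta>\<^sup>2 / sqrt \<delta>) / 2)"
  proof -
    have "K * \<delta>\<^sup>2 \<le> K * \<delta>" using K \<delta> by (intro mult_left_mono) (auto simp: power2_eq_square mult_left_le)
    then have "(LINT x|\<gamma>. x ^ 2) \<le> \<delta> + K * \<delta>" using v by linarith
    then show ?thesis using d q C
      by (intro mult_left_mono divide_right_mono add_mono) auto
  qed
  also have "\<dots> = C * (1 / 2 + K) * (\<delta> * sqrt \<delta>)"
  proof -
    have "\<delta>\<^sup>2 / sqrt \<delta> = \<delta> * sqrt \<delta>" using d by (simp add: field_simps power2_eq_square)
    then have "K * \<delta>\<^sup>2 / sqrt \<delta> = K * (\<delta> * sqrt \<delta>)" by (metis times_divide_eq_right)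
    then show ?thesis by (simp add: algebra_simps)
  qed
  finally have 1: "\<bar>(LINT x|\<gamma>. u x) - (u 0 + b2 / 2 * (LINT x|\<gamma>. x ^ 2))\<bar> \<le> C * (1 / 2 + K) * (\<delta> * sqrt \<delta>)" .
  have "\<bar>b2 / 2 * (LINT x|\<gamma>. x ^ 2) - b2 / 2 * \<delta>\<bar> = \<bar>b2\<bar> / 2 * \<bar>(LINT x|\<gamma>. x ^ 2) - \<delta>\<bar>"
    by (metis abs_mult abs_divide abs_numeral right_diff_distrib)
  also have "\<dots> \<le> C / 2 * (K * (\<delta> * sqrt \<delta>))"
    using b2 v d2 K by (intro mult_mono order_trans[OF v] mult_left_mono) auto
  finally have 2: "\<bar>b2 / 2 * (LINT x|\<gamma>. x ^ 2) - b2 / 2 * \<delta>\<bar> \<le> C / 2 * (K * (\<delta> * sqrt \<delta>))" .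
  have "\<bar>(LINT x|\<gamma>. u x) - (u 0 + b2 / 2 * \<delta>)\<bar> \<le> C * (1 / 2 + K) * (\<delta> * sqrt \<delta>) + C / 2 * (K * (\<delta> * sqrt \<delta>))"
    using 1 2 by linarith
  also have "\<dots> = C * (1 / 2 + 3 / 2 * K) * (\<delta> * sqrt \<delta>)" by (simp add: algebra_simps)
  also have "\<dots> \<le> C * (1 + 2 * K) * (\<delta> * sqrt \<delta>)"
    using C K \<delta> by (intro mult_right_mono mult_left_mono) auto
  finally show ?thesis .
qed

lemma step_law_replacement:
  fixes \<theta> \<eta> c d \<delta> K :: real and \<gamma> \<gamma>' :: "real measure"
  assumes "step_law K \<delta> \<gamma>" "step_law K \<delta> \<gamma>'" "K \<ge> 0" "0 < \<delta>" "\<delta> \<le> 1" "c \<ge> 0" "d > 0"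
  shows "\<bar>(LINT x|\<gamma>. cos (\<theta> * ln (c + d * exp x) + \<eta>)) - (LINT x|\<gamma>'. cos (\<theta> * ln (c + d * exp x) + \<eta>))\<bar>
     \<le> 2 * (\<bar>\<theta>\<bar> + 3 * \<theta>\<^sup>2 + \<bar>\<theta>\<bar> ^ 3) * (1 + 2 * K) * (\<delta> * sqrt \<delta>)"
proof -
  let ?C = "\<bar>\<theta>\<bar> + 3 * \<theta>\<^sup>2 + \<bar>\<theta>\<bar> ^ 3"
  let ?u = "\<lambda>x. cos (\<theta> * ln (c + d * exp x) + \<eta>)"
  obtain b1 b2 where b2: "\<bar>b2\<bar> \<le> \<bar>\<theta>\<bar> + \<theta>\<^sup>2"
    and T: "\<And>x. \<bar>?u x - (?u 0 + b1 * x + b2 / 2 * x ^ 2)\<bar> \<le> ?C * \<bar>x\<bar> ^ 3"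
    using cos_ln_affine_exp_Taylor[OF assms(6,7)] by blast
  have "\<bar>b2\<bar> \<le> ?C" using b2 by (smt (verit) zero_le_power2 zero_le_power)
  then have "\<bar>(LINT x|g. ?u x) - (?u 0 + b2 / 2 * \<delta>)\<bar> \<le> ?C * (1 + 2 * K) * (\<delta> * sqrt \<delta>)"
    if "step_law K \<delta> g" for g
    using that assms T by (intro step_law_cos_expectation[where ?b1.0 = b1]) auto
  from this[OF assms(1)] this[OF assms(2)] show ?thesis by linarith
qed


section \<open>The multiplicative chain: one-step identities and replacement of the step law\<close>

primrec chain_law :: "real measure \<Rightarrow> real \<Rightarrow> nat \<Rightarrow> real measure" where
  "chain_law \<gamma> \<delta> 0 = return borel 0"
| "chain_law \<gamma> \<delta> (Suc n) =
     distr (\<gamma> \<Otimes>\<^sub>M chain_law \<gamma> \<delta> n) borel (\<lambda>(x, a). exp x * (a + \<delta>))"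

lemma sets_chain_law [measurable_cong, simp]: "sets (chain_law \<gamma> \<delta> n) = sets borel"
  by (cases n) simp_all

lemma space_chain_law [simp]: "space (chain_law \<gamma> \<delta> n) = UNIV"
  by (cases n) simp_all

lemma measurable_chain_step [measurable]:
  fixes \<gamma> :: "real measure" and \<nu> :: "real measure"
  assumes [measurable_cong]: "sets \<gamma> = sets borel" "sets \<nu> = sets borel"
  shows "(\<lambda>(x, a). exp x * (a + \<delta>)) \<in> borel_measurable (\<gamma> \<Otimes>\<^sub>M \<nu>)"
  by measurable

lemma prob_space_chain_law:
  assumes "prob_space \<gamma>" and [measurable_cong]: "sets \<gamma> = sets borel"
  shows "prob_space (chain_law \<gamma> \<delta> n)"
proof (induction n)
  case 0
  show ?case by (simp add: prob_space_return)
next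
  case (Suc n)
  interpret \<gamma>: prob_space \<gamma> by fact
  interpret \<nu>: prob_space "chain_law \<gamma> \<delta> n" by fact
  interpret pair_prob_space \<gamma> "chain_law \<gamma> \<delta> n" ..
  show ?case by (simp, rule prob_space_distr) simp
qed

text \<open>Fubini in both orders. With the step outside, the induction hypothesis applies to the
  inner chain; with the chain outside, two step laws can be compared at a fixed state.\<close>

lemma integral_chain_law_Suc:
  fixes f :: "real \<Rightarrow> real"
  assumes "prob_space \<gamma>" and [measurable_cong]: "sets \<gamma> = sets borel"
    and [measurable]: "f \<in> borel_measurable borel" and b: "\<And>x. \<bar>f x\<bar> \<le> C"
  shows "(LINT a|chain_law \<gamma> \<delta> (Suc n). f a) = (LINT x|\<gamma>. LINT a|chain_law \<gamma> \<delta> n. f (exp x * (a + \<delta>)))"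
    and "(LINT a|chain_law \<gamma> \<delta> (Suc n). f a) = (LINT a|chain_law \<gamma> \<delta> n. LINT x|\<gamma>. f (exp x * (a + \<delta>)))"
    and "integrable \<gamma> (\<lambda>x. LINT a|chain_law \<gamma> \<delta> n. f (exp x * (a + \<delta>)))"
    and "integrable (chain_law \<gamma> \<delta> n) (\<lambda>a. LINT x|\<gamma>. f (exp x * (a + \<delta>)))"
proof -
  interpret \<gamma>: prob_space \<gamma> by fact
  interpret \<nu>: prob_space "chain_law \<gamma> \<delta> n" by (rule prob_space_chain_law) fact+
  interpret pair_prob_space \<gamma> "chain_law \<gamma> \<delta> n" ..
  have i: "integrable (\<gamma> \<Otimes>\<^sub>M chain_law \<gamma> \<delta> n) (\<lambda>(x, a). f (exp x * (a + \<delta>)))"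
    using b by (intro integrable_const_bound[where B = C]) (auto intro!: AE_I2)
  have "(LINT a|chain_law \<gamma> \<delta> (Suc n). f a) = (LINT (x, a)|(\<gamma> \<Otimes>\<^sub>M chain_law \<gamma> \<delta> n). f (exp x * (a + \<delta>)))"
    by (simp add: integral_distr case_prod_unfold)
  then show "(LINT a|chain_law \<gamma> \<delta> (Suc n). f a) = (LINT x|\<gamma>. LINT a|chain_law \<gamma> \<delta> n. f (exp x * (a + \<delta>)))"
    and "(LINT a|chain_law \<gamma> \<delta> (Suc n). f a) = (LINT a|chain_law \<gamma> \<delta> n. LINT x|\<gamma>. f (exp x * (a + \<delta>)))"
    using integral_fst[OF i] integral_snd[OF i] by simp_all
  show "integrable \<gamma> (\<lambda>x. LINT a|chain_law \<gamma> \<delta> n. f (exp x * (a + \<delta>)))"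
    using integrable_fst[OF i] .
  show "integrable (chain_law \<gamma> \<delta> n) (\<lambda>a. LINT x|\<gamma>. f (exp x * (a + \<delta>)))"
    using integrable_snd[OF i] .
qed

text \<open>Strict positivity begins with the first step, since the chain starts at
  \<open>0\<close>. It is what makes events about \<open>ln\<close> of the state equivalent to
  events about the state.\<close>

lemma AE_chain_law_nonneg:
  assumes "prob_space \<gamma>" and [measurable_cong]: "sets \<gamma> = sets borel" and "\<delta> > 0"
  shows "AE a in chain_law \<gamma> \<delta> n. a \<ge> 0" and "n > 0 \<Longrightarrow> AE a in chain_law \<gamma> \<delta> n. a > 0"
proof -
  have step: "AE a in chain_law \<gamma> \<delta> (Suc n). a > 0" if "AE a in chain_law \<gamma> \<delta> n. a \<ge> 0" for n
  proof -
    interpret \<gamma>: prob_space \<gamma> by fact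
    interpret \<nu>: prob_space "chain_law \<gamma> \<delta> n" by (rule prob_space_chain_law) fact+
    interpret pair_prob_space \<gamma> "chain_law \<gamma> \<delta> n" ..
    have "AE z in \<gamma> \<Otimes>\<^sub>M chain_law \<gamma> \<delta> n. snd z \<ge> 0"
    proof (rule AE_pair_measure)
      show "{z \<in> space (\<gamma> \<Otimes>\<^sub>M chain_law \<gamma> \<delta> n). 0 \<le> snd z} \<in> sets (\<gamma> \<Otimes>\<^sub>M chain_law \<gamma> \<delta> n)"
        by measurable
    qed (use that in auto)
    then have "AE z in \<gamma> \<Otimes>\<^sub>M chain_law \<gamma> \<delta> n. (case z of (x, a) \<Rightarrow> exp x * (a + \<delta>)) > 0"
      by (rule eventually_mono) (use \<open>\<delta> > 0\<close> in \<open>auto simp: add_nonneg_pos\<close>)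
    then show ?thesis
      unfolding chain_law.simps by (subst AE_distr_iff) auto
  qed
  show nn: "AE a in chain_law \<gamma> \<delta> n. a \<ge> 0" for n
  proof (induction n)
    case 0
    show ?case unfolding chain_law.simps by (subst AE_return) auto
  next
    case (Suc n)
    show ?case by (rule eventually_mono[OF step[OF Suc]]) simp
  qed
  show "AE a in chain_law \<gamma> \<delta> n. a > 0" if "n > 0"
    using step[OF nn, of "n - 1"] unfolding Suc_pred'[OF that, symmetric] .
qed

text \<open>This is the one-step operator acting on distribution functions, the form in which
  convexity is propagated.\<close>

lemma chain_law_atMost_Suc:
  assumes "prob_space \<gamma>" and [measurable_cong]: "sets \<gamma> = sets borel"
  shows "measure (chain_law \<gamma> \<delta> (Suc n)) {..y} = (LINT x|\<gamma>. measure (chain_law \<gamma> \<delta> n) {..y * exp (- x) - \<delta>})"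
proof -
  have "measure (chain_law \<gamma> \<delta> (Suc n)) {..y} = (LINT a|chain_law \<gamma> \<delta> (Suc n). indicator {..y} a)"
    by simp
  also have "\<dots> = (LINT x|\<gamma>. LINT a|chain_law \<gamma> \<delta> n. indicator {..y} (exp x * (a + \<delta>)))"
    by (rule integral_chain_law_Suc[where C = 1]) (use assms in \<open>auto simp: indicator_def\<close>)
  also have "\<dots> = (LINT x|\<gamma>. LINT a|chain_law \<gamma> \<delta> n. indicator {..y * exp (- x) - \<delta>} a)"
    by (intro Bochner_Integration.integral_cong refl) (auto simp: indicator_def exp_minus field_simps)
  finally show ?thesis by simp
qed

text \<open>Lindeberg's telescoping as an induction. Conditioning on the last step \<open>x\<close>
  turns \<open>c + d * (exp x * (a + \<delta>))\<close> into an affine function of \<open>a\<close>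
  with new coefficients \<open>c + d * exp x * \<delta>\<close> and \<open>d * exp x\<close>, which
  is why \<open>c\<close> and \<open>d\<close> are arbitrary in the induction.\<close>

lemma chain_law_replacement:
  fixes \<theta> \<eta> c d \<delta> K :: real and \<gamma> \<gamma>' :: "real measure"
  assumes s: "step_law K \<delta> \<gamma>" "step_law K \<delta> \<gamma>'" "K \<ge> 0" "0 < \<delta>" "\<delta> \<le> 1"
  assumes "c \<ge> 0" "d > 0"
  shows "\<bar>(LINT a|chain_law \<gamma> \<delta> n. cos (\<theta> * ln (c + d * a) + \<eta>)) - (LINT a|chain_law \<gamma>' \<delta> n. cos (\<theta> * ln (c + d * a) + \<eta>))\<bar>
     \<le> real n * (2 * (\<bar>\<theta>\<bar> + 3 * \<theta>\<^sup>2 + \<bar>\<theta>\<bar> ^ 3) * (1 + 2 * K) * (\<delta> * sqrt \<delta>))" (is "_ \<le> real n * ?e")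
  using \<open>c \<ge> 0\<close> \<open>d > 0\<close>
proof (induction n arbitrary: c d)
  case 0
  show ?case by simp
next
  case (Suc n)
  have p: "prob_space \<gamma>" "prob_space \<gamma>'" and ps [measurable_cong]: "sets \<gamma> = sets borel" "sets \<gamma>' = sets borel"
    using s by (auto simp: step_law_def)
  interpret \<gamma>: prob_space \<gamma> by fact
  interpret \<gamma>': prob_space \<gamma>' by fact
  interpret \<nu>: prob_space "chain_law \<gamma> \<delta> n" by (rule prob_space_chain_law) fact+
  interpret \<nu>': prob_space "chain_law \<gamma>' \<delta> n" by (rule prob_space_chain_law) fact+
  \<comment> \<open>The hybrid chain: \<open>n\<close> steps with \<open>\<gamma>'\<close> followed
    by one with \<open>\<gamma>\<close>. Its distance to the pure \<open>\<gamma>\<close> chain is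
    covered by the induction hypothesis, and its distance to the pure \<open>\<gamma>'\<close> chain
    by a single replacement.\<close>
  interpret \<gamma>\<nu>': pair_prob_space \<gamma> "chain_law \<gamma>' \<delta> n" ..
  let ?f = "\<lambda>a. cos (\<theta> * ln (c + d * a) + \<eta>)"
  let ?g = "\<lambda>x a. ?f (exp x * (a + \<delta>))"
  have i: "integrable (\<gamma> \<Otimes>\<^sub>M chain_law \<gamma>' \<delta> n) (\<lambda>(x, a). ?g x a)"
    by (intro \<gamma>\<nu>'.integrable_const_bound[where B = 1]) (auto intro!: AE_I2)
  have I1: "integrable \<gamma> (\<lambda>x. LINT a|chain_law \<gamma> \<delta> n. ?g x a)"
    by (rule integral_chain_law_Suc(3)[OF p(1) ps(1), where C = 1]) auto
  have I2: "integrable \<gamma> (\<lambda>x. LINT a|chain_law \<gamma>' \<delta> n. ?g x a)"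
    using \<gamma>\<nu>'.integrable_fst[OF i] by simp
  have J1: "integrable (chain_law \<gamma>' \<delta> n) (\<lambda>a. LINT x|\<gamma>. ?g x a)"
    using \<gamma>\<nu>'.integrable_snd[OF i] by simp
  have J2: "integrable (chain_law \<gamma>' \<delta> n) (\<lambda>a. LINT x|\<gamma>'. ?g x a)"
    by (rule integral_chain_law_Suc(4)[OF p(2) ps(2), where C = 1]) auto
  have "\<bar>(LINT x|\<gamma>. LINT a|chain_law \<gamma> \<delta> n. ?g x a) - (LINT x|\<gamma>. LINT a|chain_law \<gamma>' \<delta> n. ?g x a)\<bar>
      \<le> (LINT x|\<gamma>. \<bar>(LINT a|chain_law \<gamma> \<delta> n. ?g x a) - (LINT a|chain_law \<gamma>' \<delta> n. ?g x a)\<bar>)"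
    unfolding Bochner_Integration.integral_diff[OF I1 I2, symmetric] by (rule integral_abs_bound)
  also have "\<dots> \<le> (LINT x|\<gamma>. real n * ?e)"
  proof (rule integral_mono)
    show "\<bar>(LINT a|chain_law \<gamma> \<delta> n. ?g x a) - (LINT a|chain_law \<gamma>' \<delta> n. ?g x a)\<bar> \<le> real n * ?e" for x
      using Suc.IH[of "c + d * exp x * \<delta>" "d * exp x"] Suc.prems s
      by (simp add: algebra_simps add_nonneg_nonneg)
  qed (intro integrable_abs Bochner_Integration.integrable_diff I1 I2, simp)
  finally have 1: "\<bar>(LINT x|\<gamma>. LINT a|chain_law \<gamma> \<delta> n. ?g x a) - (LINT x|\<gamma>. LINT a|chain_law \<gamma>' \<delta> n. ?g x a)\<bar> \<le> real n * ?e"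
    using \<gamma>.prob_space by simp
  have "\<bar>(LINT a|chain_law \<gamma>' \<delta> n. LINT x|\<gamma>. ?g x a) - (LINT a|chain_law \<gamma>' \<delta> n. LINT x|\<gamma>'. ?g x a)\<bar>
      \<le> (LINT a|chain_law \<gamma>' \<delta> n. \<bar>(LINT x|\<gamma>. ?g x a) - (LINT x|\<gamma>'. ?g x a)\<bar>)"
    unfolding Bochner_Integration.integral_diff[OF J1 J2, symmetric] by (rule integral_abs_bound)
  also have "\<dots> \<le> (LINT a|chain_law \<gamma>' \<delta> n. ?e)"
  proof (rule integral_mono_AE)
    show "AE a in chain_law \<gamma>' \<delta> n. \<bar>(LINT x|\<gamma>. ?g x a) - (LINT x|\<gamma>'. ?g x a)\<bar> \<le> ?e"
      using AE_chain_law_nonneg(1)[OF p(2) ps(2) s(4), of n]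
    proof eventually_elim
      case (elim a)
      then show ?case
        using step_law_replacement[OF s Suc.prems(1), of "d * (a + \<delta>)" \<theta> \<eta>] Suc.prems s
        by (simp add: mult_ac)
    qed
  qed (intro integrable_abs Bochner_Integration.integrable_diff J1 J2, simp)
  finally have 2: "\<bar>(LINT a|chain_law \<gamma>' \<delta> n. LINT x|\<gamma>. ?g x a) - (LINT a|chain_law \<gamma>' \<delta> n. LINT x|\<gamma>'. ?g x a)\<bar> \<le> ?e"
    using \<nu>'.prob_space by simp
  have 3: "(LINT x|\<gamma>. LINT a|chain_law \<gamma>' \<delta> n. ?g x a) = (LINT a|chain_law \<gamma>' \<delta> n. LINT x|\<gamma>. ?g x a)"
    using \<gamma>\<nu>'.integral_fst[OF i] \<gamma>\<nu>'.integral_snd[OF i] by simp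
  have "(LINT a|chain_law \<gamma> \<delta> (Suc n). ?f a) = (LINT x|\<gamma>. LINT a|chain_law \<gamma> \<delta> n. ?g x a)"
    by (rule integral_chain_law_Suc(1)[OF p(1) ps(1), where C = 1]) auto
  moreover have "(LINT a|chain_law \<gamma>' \<delta> (Suc n). ?f a) = (LINT a|chain_law \<gamma>' \<delta> n. LINT x|\<gamma>'. ?g x a)"
    by (rule integral_chain_law_Suc(2)[OF p(2) ps(2), where C = 1]) auto
  ultimately show ?case using 1 2 3 by (simp only: of_nat_Suc distrib_right mult_1) linarith
qed

section \<open>Convexity for the Beta chain\<close>

lemma convex_on_eq:
  assumes "convex_on S f" "\<And>x. x \<in> S \<Longrightarrow> f x = g x"
  shows "convex_on S g"
  using assms unfolding convex_on_def by (metis convex_def)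

definition weight :: "real \<Rightarrow> real \<Rightarrow> real \<Rightarrow> real" where
  "weight p \<delta> a = a powr p * (a + \<delta>) powr (1 - p)"

lemma weight_pos: "a > 0 \<Longrightarrow> \<delta> > 0 \<Longrightarrow> weight p \<delta> a > 0"
  by (simp add: weight_def)

text \<open>The base case of the induction, since the point mass at \<open>0\<close> has
  distribution function \<open>1\<close> on the positive axis. The function is even log-convex:
  \<open>L''\<close> is nonnegative because \<open>p - 1 \<le> p\<close> and
  \<open>a \<le> a + \<delta>\<close>.\<close>

lemma convex_inverse_weight:
  assumes "p \<ge> 1" "\<delta> > 0"
  shows "convex_on {0<..} (\<lambda>a. 1 / weight p \<delta> a)"
proof -
  define L where "L a = (p - 1) * ln (a + \<delta>) - p * ln a" for a :: real
  define L' where "L' a = (p - 1) / (a + \<delta>) - p / a" for a :: real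
  define L'' where "L'' a = p / a\<^sup>2 - (p - 1) / (a + \<delta>)\<^sup>2" for a :: real
  have "convex_on {0<..} (\<lambda>a. exp (L a))"
  proof (rule f''_ge0_imp_convex)
    fix a :: real assume "a \<in> {0<..}"
    then have a: "a > 0" "a + \<delta> > 0" using assms by auto
    have L: "(L has_field_derivative L' a) (at a)"
      unfolding L_def L'_def using a by (auto intro!: derivative_eq_intros)
    have L': "(L' has_field_derivative L'' a) (at a)"
      unfolding L'_def L''_def using a by (auto intro!: derivative_eq_intros simp: power2_eq_square)
        (metis minus_diff_eq minus_divide_left)
    show "((\<lambda>a. exp (L a)) has_field_derivative exp (L a) * L' a) (at a)"
      by (auto intro!: derivative_eq_intros L)
    show "((\<lambda>a. exp (L a) * L' a) has_field_derivative exp (L a) * (L' a * L' a + L'' a)) (at a)"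
      by (rule derivative_eq_intros L L' refl)+ (simp add: algebra_simps)
    have "(p - 1) / (a + \<delta>)\<^sup>2 \<le> p / a\<^sup>2"
      using a assms by (intro frac_le power_mono) auto
    then show "0 \<le> exp (L a) * (L' a * L' a + L'' a)" by (simp add: L''_def)
  qed simp
  moreover have "exp (L a) = 1 / weight p \<delta> a" if "a \<in> {0<..}" for a
  proof -
    have "weight p \<delta> a = exp (- L a)"
      using that assms by (simp add: weight_def L_def powr_def exp_add[symmetric] algebra_simps)
    then show ?thesis by (simp add: exp_minus inverse_eq_divide)
  qed
  ultimately show ?thesis by (rule convex_on_eq)
qed

text \<open>To be read with \<open>A = a + \<delta>\<close>, \<open>c = a / (a + \<delta>)\<close>,
  \<open>v = 1 - w\<close>, \<open>e = 1 - c * w\<close> and \<open>B = Beta p p\<close>. The powers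
  of \<open>e\<close> in the weight and in the Beta density cancel, so that the dependence on
  \<open>a\<close> separates as \<open>A * c powr p\<close>, which is
  \<open>weight p \<delta> a\<close>.\<close>

lemma beta_weight_cancellation:
  fixes A B c e v w p :: real
  assumes "A > 0" "c > 0" "e > 0" "v > 0" "w > 0"
  shows "(A * v / w) powr p * (A * e / w) powr (1 - p) * ((c * w) powr (p - 1) * e powr (p - 1) / B * c)
    = (A * c powr p) * (v powr p * w powr (p - 2) / B)"
proof -
  have 1: "(A * v / w) powr p = A powr p * v powr p / w powr p"
    and 2: "(A * e / w) powr (1 - p) = (A * e / w) * w powr p / (A powr p * e powr p)"
    and 3: "(c * w) powr (p - 1) = c powr p * w powr p / (c * w)"
    and 4: "e powr (p - 1) = e powr p / e"
    and 5: "w powr (p - 2) = w powr p / (w * w)"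
    using assms by (simp_all add: powr_mult powr_divide powr_diff power2_eq_square)
  have pos: "A powr p > 0" "e powr p > 0" "w powr p > 0" using assms by simp_all
  show ?thesis unfolding 1 2 3 4 5 using assms pos by (simp add: divide_simps)
qed

text \<open>
  The substitution \<open>u = a / (a + \<delta>) * w\<close> in the Beta integral takes \<open>a\<close> out of the range of integration
  and leaves it only in the argument of the convex function.
\<close>
lemma convex_ratio_step:
  assumes p: "p > 0" and \<delta>: "\<delta> > 0"
    and [measurable]: "F \<in> borel_measurable borel"
    and F01: "\<And>y. 0 \<le> F y" "\<And>y. F y \<le> 1" and F0: "\<And>y. y < 0 \<Longrightarrow> F y = 0"
    and conv: "convex_on {0<..} (\<lambda>a. F a / weight p \<delta> a)"
  shows "convex_on {0<..} (\<lambda>a. (LINT x|logit_beta p. F (a * exp (- x) - \<delta>)) / weight p \<delta> a)"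
proof -
  let ?w = "beta_density p"
  define k where "k y = F y / weight p \<delta> y" for y
  \<comment> \<open>The averaging kernel, with \<open>(1 - w) / w\<close> in the role of the random
    variable \<open>V\<close>. For \<open>p > 1\<close> it is the Beta density with parameters
    \<open>p - 1\<close> and \<open>p + 1\<close>, times the constant
    \<open>p / (p - 1)\<close>.\<close>
  define J where "J w = indicator {0<..<1} w * ((1 - w) powr p * w powr (p - 2)) / Beta p p" for w :: real
  have J0: "J w \<ge> 0" for w using Beta_pos[of p p] p by (simp add: J_def)
  have w0: "?w u = 0" if "\<not> (0 < u \<and> u < 1)" for u
    using that by (auto simp: beta_density_def indicator_def)
  have int_w: "integrable lborel ?w"
    using integrable_divide[OF integrable.intros[OF has_bochner_integral_Beta[OF p p]], of "Beta p p"]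
    by (simp add: beta_density_def[abs_def])
  have subst: "weight p \<delta> ((a + \<delta>) * (1 - w) / w) * (?w (c * w) * c) = weight p \<delta> a * J w"
    if a: "a > 0" and w: "0 < w" "w < 1" and c: "c = a / (a + \<delta>)" for a w c
  proof -
    have ad: "a + \<delta> > 0" using a \<delta> by simp
    have c01: "0 < c" "c < 1" using a \<delta> c by auto
    have cw: "0 < c * w" "c * w < 1" using c01 w mult_strict_mono[of c 1 w 1] by auto
    have y: "(a + \<delta>) * (1 - w) / w + \<delta> = (a + \<delta>) * (1 - c * w) / w"
    proof -
      have "(a + \<delta>) * (1 - c * w) = a + \<delta> - a * w" using ad unfolding c by (simp add: field_simps)
      moreover have "(a + \<delta>) * (1 - w) / w + \<delta> = (a + \<delta> - a * w) / w"
        using w by (simp add: field_simps)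
      ultimately show ?thesis by simp
    qed
    have "weight p \<delta> ((a + \<delta>) * (1 - w) / w) * (?w (c * w) * c)
      = ((a + \<delta>) * (1 - w) / w) powr p * ((a + \<delta>) * (1 - c * w) / w) powr (1 - p)
        * ((c * w) powr (p - 1) * (1 - c * w) powr (p - 1) / Beta p p * c)"
      using cw by (simp add: weight_def y beta_density_def)
    also have "\<dots> = ((a + \<delta>) * c powr p) * ((1 - w) powr p * w powr (p - 2) / Beta p p)"
      using ad w cw c01 by (intro beta_weight_cancellation) auto
    also have "(a + \<delta>) * c powr p = weight p \<delta> a"
      using ad a unfolding c by (simp add: weight_def powr_divide powr_diff)
    also have "(1 - w) powr p * w powr (p - 2) / Beta p p = J w"
      using w by (simp add: J_def)
    finally show ?thesis .
  qed
  have key: "integrable lborel (\<lambda>w. J w * k ((a + \<delta>) * (1 - w) / w))"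
    "(LINT x|logit_beta p. F (a * exp (- x) - \<delta>)) / weight p \<delta> a = (LINT w|lborel. J w * k ((a + \<delta>) * (1 - w) / w))"
    if a: "a > 0" for a
  proof -
    define c where "c = a / (a + \<delta>)"
    have c: "c > 0" using a \<delta> by (simp add: c_def)
    define f where "f u = ?w u * F (a * exp (- ln (u / (1 - u))) - \<delta>)" for u
    have f: "integrable lborel f"
      unfolding f_def
      by (rule Bochner_Integration.integrable_bound[OF int_w])
         (use F01 beta_density_nonneg[OF p] in \<open>auto intro!: AE_I2 mult_left_le simp: abs_mult\<close>)
    have aff: "a * exp (- ln (u / (1 - u))) - \<delta> = (a - (a + \<delta>) * u) / u" if "0 < u" "u < 1" for u
      using that by (simp add: exp_minus field_simps)
    have cw: "(a - (a + \<delta>) * (c * w)) / (c * w) = (a + \<delta>) * (1 - w) / w" for w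
    proof -
      have "(a + \<delta>) * (c * w) = a * w" using a \<delta> by (simp add: c_def)
      then have "(a - (a + \<delta>) * (c * w)) / (c * w) = (a / c) * ((1 - w) / w)" by (simp add: algebra_simps)
      also have "a / c = a + \<delta>" using a by (simp add: c_def)
      finally show ?thesis by simp
    qed
    \<comment> \<open>The point \<open>w = 1\<close> has to be left out: there \<open>J\<close>
      vanishes, while \<open>F 0\<close> may be positive, as it is for the point mass at
      \<open>0\<close>.\<close>
    have eq: "AE w in lborel. f (0 + c * w) * c = weight p \<delta> a * (J w * k ((a + \<delta>) * (1 - w) / w))"
    proof (rule eventually_mono[OF AE_lborel_singleton[of 1]])
      fix w :: real assume "w \<noteq> 1"
      consider "w \<le> 0" | "0 < w \<and> w < 1" | "w > 1" using \<open>w \<noteq> 1\<close> by linarith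
      then show "f (0 + c * w) * c = weight p \<delta> a * (J w * k ((a + \<delta>) * (1 - w) / w))"
      proof cases
        case 1
        then have "\<not> 0 < c * w" using c by (simp add: mult_nonneg_nonpos not_less)
        then show ?thesis using 1 by (simp add: f_def w0 J_def)
      next
        \<comment> \<open>Because \<open>c < 1\<close>, the variable \<open>u = c * w\<close> can
          still lie below \<open>1\<close> when \<open>w > 1\<close>. The left side then vanishes
          because the argument of \<open>F\<close> is negative.\<close>
        case 3
        have "f (c * w) = 0"
        proof (cases "0 < c * w \<and> c * w < 1")
          case True
          then have "a * exp (- ln (c * w / (1 - c * w))) - \<delta> = (a + \<delta>) * (1 - w) / w"
            by (simp only: aff cw)
          also have "\<dots> < 0" using 3 a \<delta> by (simp add: divide_neg_pos mult_pos_neg)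
          finally show ?thesis by (simp add: f_def F0)
        qed (simp add: f_def w0)
        then show ?thesis using 3 by (simp add: J_def)
      next
        case 2
        have c1: "c < 1" using a \<delta> by (simp add: c_def)
        have "0 < c * w" "c * w < 1" using c c1 2 mult_strict_mono[of c 1 w 1] by auto
        then have y: "a * exp (- ln (c * w / (1 - c * w))) - \<delta> = (a + \<delta>) * (1 - w) / w"
          by (simp only: aff cw)
        have ypos: "(a + \<delta>) * (1 - w) / w > 0" using a \<delta> 2 by simp
        have "F ((a + \<delta>) * (1 - w) / w) = weight p \<delta> ((a + \<delta>) * (1 - w) / w) * k ((a + \<delta>) * (1 - w) / w)"
          using weight_pos[OF ypos \<delta>, of p] by (simp add: k_def)
        then have "f (0 + c * w) * c = (weight p \<delta> ((a + \<delta>) * (1 - w) / w) * (?w (c * w) * c)) * k ((a + \<delta>) * (1 - w) / w)"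
          unfolding f_def add_0 y by simp
        then show ?thesis using subst[OF a _ _ c_def, of w] 2 by simp
      qed
    qed
    have W: "weight p \<delta> a > 0" using weight_pos a \<delta> by simp
    have [measurable]: "k \<in> borel_measurable borel" unfolding k_def weight_def by measurable
    have [measurable]: "J \<in> borel_measurable borel" unfolding J_def by measurable
    have [measurable]: "f \<in> borel_measurable borel" using f by simp
    have fc: "integrable lborel (\<lambda>w. f (0 + c * w) * c)"
      using lborel_integrable_real_affine[OF f, of c 0] c by simp
    then have i: "integrable lborel (\<lambda>w. weight p \<delta> a * (J w * k ((a + \<delta>) * (1 - w) / w)))"
      using integrable_cong_AE[OF _ _ eq] by simp
    then show "integrable lborel (\<lambda>w. J w * k ((a + \<delta>) * (1 - w) / w))"
      using W by simp
    have "(LINT x|logit_beta p. F (a * exp (- x) - \<delta>)) = (LINT u|lborel. f u)"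
      unfolding logit_beta_def f_def using beta_density_nonneg[OF p]
      by (simp add: integral_distr integral_density)
    also have "\<dots> = (LINT w|lborel. f (0 + c * w) * c)"
      using lborel_integral_real_affine[of c f 0] c by (simp add: mult.commute)
    also have "\<dots> = (LINT w|lborel. weight p \<delta> a * (J w * k ((a + \<delta>) * (1 - w) / w)))"
      by (rule integral_cong_AE[OF _ _ eq]) measurable
    finally show "(LINT x|logit_beta p. F (a * exp (- x) - \<delta>)) / weight p \<delta> a = (LINT w|lborel. J w * k ((a + \<delta>) * (1 - w) / w))"
      using W by simp
  qed
  have "convex_on {0<..} (\<lambda>a. LINT w|lborel. J w * k ((a + \<delta>) * (1 - w) / w))"
  proof (rule convex_onI)
    fix t a b :: real assume t: "0 < t" "t < 1" and ab: "a \<in> {0<..}" "b \<in> {0<..}"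
    have m: "(1 - t) *\<^sub>R a + t *\<^sub>R b > 0" using t ab by (simp add: add_pos_pos)
    have "(LINT w|lborel. J w * k (((1 - t) *\<^sub>R a + t *\<^sub>R b + \<delta>) * (1 - w) / w))
      \<le> (LINT w|lborel. (1 - t) * (J w * k ((a + \<delta>) * (1 - w) / w)) + t * (J w * k ((b + \<delta>) * (1 - w) / w)))"
    proof (rule integral_mono)
      show "integrable lborel (\<lambda>w. J w * k (((1 - t) *\<^sub>R a + t *\<^sub>R b + \<delta>) * (1 - w) / w))"
        by (rule key(1)[OF m])
      show "integrable lborel (\<lambda>w. (1 - t) * (J w * k ((a + \<delta>) * (1 - w) / w)) + t * (J w * k ((b + \<delta>) * (1 - w) / w)))"
        using key(1)[of a] key(1)[of b] ab by simp
      fix w :: real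
      show "J w * k (((1 - t) *\<^sub>R a + t *\<^sub>R b + \<delta>) * (1 - w) / w)
        \<le> (1 - t) * (J w * k ((a + \<delta>) * (1 - w) / w)) + t * (J w * k ((b + \<delta>) * (1 - w) / w))"
      proof (cases "0 < w \<and> w < 1")
        case True
        \<comment> \<open>For fixed \<open>w\<close> the argument of \<open>k\<close> is affine in
          \<open>a\<close>, so convexity of \<open>k\<close> passes to the integrand and, as
          \<open>J\<close> is nonnegative, to the integral.\<close>
        have "((1 - t) *\<^sub>R a + t *\<^sub>R b + \<delta>) * (1 - w) / w
            = (1 - t) *\<^sub>R ((a + \<delta>) * (1 - w) / w) + t *\<^sub>R ((b + \<delta>) * (1 - w) / w)"
          using True by (simp add: field_simps)
        also have "k \<dots> \<le> (1 - t) * k ((a + \<delta>) * (1 - w) / w) + t * k ((b + \<delta>) * (1 - w) / w)"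
          using conv True t ab \<delta> unfolding k_def by (intro convex_onD) auto
        finally show ?thesis
          by (rule mult_left_mono[OF _ J0[of w], THEN order_trans]) (simp only: distrib_left mult.left_commute[of "J w"] order_refl)
      qed (simp add: J_def)
    qed
    then show "(LINT w|lborel. J w * k (((1 - t) *\<^sub>R a + t *\<^sub>R b + \<delta>) * (1 - w) / w))
      \<le> (1 - t) * (LINT w|lborel. J w * k ((a + \<delta>) * (1 - w) / w)) + t * (LINT w|lborel. J w * k ((b + \<delta>) * (1 - w) / w))"
      using key(1)[of a] key(1)[of b] ab by simp
  qed (simp add: convex_real_interval)
  then show ?thesis
    by (rule convex_on_eq) (use key(2) in simp)
qed

lemma convex_chain_law_ratio:
  assumes p: "p \<ge> 1" and \<delta>: "\<delta> > 0"
  shows "convex_on {0<..} (\<lambda>a. measure (chain_law (logit_beta p) \<delta> n) {..a} / weight p \<delta> a)"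
proof (induction n)
  case 0
  show ?case
    by (rule convex_on_eq[OF convex_inverse_weight[OF assms]]) (simp add: measure_return)
next
  case (Suc n)
  have pl: "prob_space (logit_beta p)" using p by (intro prob_space_logit_beta) simp
  interpret \<nu>: prob_space "chain_law (logit_beta p) \<delta> n"
    by (rule prob_space_chain_law[OF pl]) simp
  have "measure (chain_law (logit_beta p) \<delta> n) {..y} = 0" if "y < 0" for y
  proof -
    have "AE a in chain_law (logit_beta p) \<delta> n. a \<notin> {..y}"
      using AE_chain_law_nonneg(1)[OF pl _ \<delta>, of n] that by (auto elim!: eventually_mono)
    then show ?thesis by (subst \<nu>.prob_eq_0) auto
  qed
  moreover have "(\<lambda>y. measure (chain_law (logit_beta p) \<delta> n) {..y}) \<in> borel_measurable borel"
    by (intro borel_measurable_mono monoI \<nu>.finite_measure_mono) auto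
  ultimately show ?case
    unfolding chain_law_atMost_Suc[OF pl sets_logit_beta]
    using p \<delta> Suc by (intro convex_ratio_step) auto
qed

section \<open>Discretisation of the exponential functional\<close>

text \<open>Right endpoints match the chain, whose noise factor also multiplies the newly added
  \<open>\<delta>\<close>. The induction runs over \<open>m\<close> with \<open>n\<close> fixed, so
  that the oscillation bound on the full interval stays available.\<close>

lemma riemann_sum_error:
  fixes f :: "real \<Rightarrow> real"
  assumes "\<delta> > 0" "continuous_on {0..real n * \<delta>} f"
    and e: "\<And>x y. x \<in> {0..real n * \<delta>} \<Longrightarrow> y \<in> {0..real n * \<delta>} \<Longrightarrow> \<bar>x - y\<bar> \<le> \<delta> \<Longrightarrow> \<bar>f x - f y\<bar> \<le> e"
  shows "m \<le> n \<Longrightarrow> \<bar>(\<Sum>k<m. \<delta> * f (real (Suc k) * \<delta>)) - integral {0..real m * \<delta>} f\<bar> \<le> real m * \<delta> * e"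
proof (induction m)
  case 0
  show ?case by simp
next
  case (Suc m)
  have sub: "{0..real (Suc m) * \<delta>} \<subseteq> {0..real n * \<delta>}"
    using Suc.prems \<open>\<delta> > 0\<close> by (intro atLeastatMost_subset_iff[THEN iffD2]) (auto intro!: mult_right_mono)
  have le: "0 \<le> real m * \<delta>" "real m * \<delta> \<le> real (Suc m) * \<delta>" using \<open>\<delta> > 0\<close> by (auto intro: mult_right_mono)
  have int: "f integrable_on {0..real (Suc m) * \<delta>}"
    by (intro integrable_continuous_real continuous_on_subset[OF assms(2) sub])
  let ?I = "{real m * \<delta>..real (Suc m) * \<delta>}"
  have int': "f integrable_on ?I"
    using le by (intro integrable_subinterval_real[OF int]) auto
  have split: "integral {0..real (Suc m) * \<delta>} f = integral {0..real m * \<delta>} f + integral ?I f"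
    using Henstock_Kurzweil_Integration.integral_combine[OF le int] by simp
  have "((\<lambda>s. f (real (Suc m) * \<delta>) - f s) has_integral (\<delta> * f (real (Suc m) * \<delta>) - integral ?I f)) ?I"
    using has_integral_diff[OF has_integral_const_real[of "f (real (Suc m) * \<delta>)" "real m * \<delta>" "real (Suc m) * \<delta>"] integrable_integral[OF int']] le
    by (simp add: algebra_simps)
  moreover have "((\<lambda>s. e) has_integral (\<delta> * e)) ?I"
    using has_integral_const_real[of e "real m * \<delta>" "real (Suc m) * \<delta>"] le by (simp add: algebra_simps)
  moreover have b: "norm (f (real (Suc m) * \<delta>) - f s) \<le> e" if "s \<in> ?I" for s
    using that sub le by (intro e[unfolded real_norm_def[symmetric]]) (auto simp: algebra_simps intro: order_trans[OF le(1)])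
  ultimately have "norm (\<delta> * f (real (Suc m) * \<delta>) - integral ?I f) \<le> \<delta> * e"
    by (metis (no_types, lifting) integral_norm_bound_integral has_integral_integrable integral_unique)
  then show ?case
    using Suc.IH Suc.prems unfolding split by (simp add: algebra_simps)
qed

lemma riemann_sum_tendsto:
  fixes f :: "real \<Rightarrow> real"
  assumes t: "t > 0" and f: "continuous_on {0..t} f"
  shows "(\<lambda>n. \<Sum>k<Suc n. t / real (Suc n) * f (real (Suc k) * (t / real (Suc n)))) \<longlonglongrightarrow> integral {0..t} f"
proof (rule metric_LIMSEQ_I)
  fix r :: real assume r: "r > 0"
  \<comment> \<open>An oscillation of at most \<open>e\<close> on each cell gives a total error of
    at most \<open>t * e = r / 2\<close>.\<close>
  define e where "e = r / (2 * t)"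
  have e: "e > 0" using r t by (simp add: e_def)
  have "uniformly_continuous_on {0..t} f"
    using f by (intro compact_uniformly_continuous) auto
  then obtain d where d: "d > 0" and D: "\<And>x y. x \<in> {0..t} \<Longrightarrow> y \<in> {0..t} \<Longrightarrow> dist y x < d \<Longrightarrow> dist (f y) (f x) < e"
    using e unfolding uniformly_continuous_on_def by metis
  obtain N where N: "t / d < real N" using reals_Archimedean2 by blast
  have "dist (\<Sum>k<Suc n. t / real (Suc n) * f (real (Suc k) * (t / real (Suc n)))) (integral {0..t} f) < r"
    if "n \<ge> N" for n
  proof -
    let ?\<delta> = "t / real (Suc n)"
    have nt: "real (Suc n) * ?\<delta> = t" by simp
    have "t / d < real (Suc n)" using N that by linarith
    then have "?\<delta> < d" using d by (simp add: field_simps)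
    then have "\<bar>f x - f y\<bar> \<le> e" if "x \<in> {0..t}" "y \<in> {0..t}" "\<bar>x - y\<bar> \<le> ?\<delta>" for x y
      using D[of y x] that by (simp add: dist_real_def)
    then have "\<bar>(\<Sum>k<Suc n. ?\<delta> * f (real (Suc k) * ?\<delta>)) - integral {0..real (Suc n) * ?\<delta>} f\<bar> \<le> real (Suc n) * ?\<delta> * e"
      using f t by (intro riemann_sum_error[where n = "Suc n"]) (unfold nt, auto)
    then have "\<bar>(\<Sum>k<Suc n. ?\<delta> * f (real (Suc k) * ?\<delta>)) - integral {0..t} f\<bar> \<le> t * e"
      unfolding nt .
    also have "t * e < r" using r t by (simp add: e_def)
    finally show ?thesis by (simp only: dist_real_def)
  qed
  then show "\<exists>N. \<forall>n\<ge>N. dist (\<Sum>k<Suc n. t / real (Suc n) * f (real (Suc k) * (t / real (Suc n)))) (integral {0..t} f) < r"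
    by blast
qed

section \<open>The Gaussian chain inside the Brownian path\<close>

definition incr_sum :: "(real \<Rightarrow> 'a \<Rightarrow> real) \<Rightarrow> real \<Rightarrow> nat \<Rightarrow> nat \<Rightarrow> 'a \<Rightarrow> real" where
  "incr_sum B \<delta> m i \<omega> = (\<Sum>k<m. \<delta> * exp (B (real (i + Suc k) * \<delta>) \<omega> - B (real i * \<delta>) \<omega>))"

text \<open>Factoring out the increment from step \<open>i\<close> to step \<open>Suc i\<close>
  displays one chain step applied to the sum that starts at \<open>Suc i\<close>. Each new chain
  step thus uses an increment earlier in time than those already used.\<close>

lemma incr_sum_Suc:
  "incr_sum B \<delta> (Suc m) i \<omega> =
     exp (B (real (Suc i) * \<delta>) \<omega> - B (real i * \<delta>) \<omega>) * (incr_sum B \<delta> m (Suc i) \<omega> + \<delta>)"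
  unfolding incr_sum_def sum.lessThan_Suc_shift
  by (simp add: distrib_left sum_distrib_left exp_diff add.commute mult_ac)

text \<open>By telescoping, \<open>incr_sum B \<delta> m (Suc i)\<close> is a measurable function of
  the increments with indices from \<open>Suc i\<close> on, a set disjoint from
  \<open>{i}\<close>.\<close>

lemma (in std_brownian_motion) increments_indep_var:
  assumes "\<delta> > 0"
  shows "indep_var borel (\<lambda>\<omega>. B (real (Suc i) * \<delta>) \<omega> - B (real i * \<delta>) \<omega>) borel (incr_sum B \<delta> m (Suc i))"
proof -
  let ?X = "\<lambda>j \<omega>. B (real (Suc j) * \<delta>) \<omega> - B (real j * \<delta>) \<omega>"
  let ?J = "{Suc i..<Suc i + m}"
  have "mono (\<lambda>i. real i * \<delta>)" using assms by (auto intro!: monoI mult_right_mono)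
  then have "indep_vars (\<lambda>_. borel) ?X {..<Suc i + m}"
    using indep_increments[of "\<lambda>i. real i * \<delta>" "Suc i + m"] by simp
  then have "indep_var (PiM {i} (\<lambda>_. borel)) (\<lambda>\<omega>. restrict (\<lambda>j. ?X j \<omega>) {i})
                       (PiM ?J (\<lambda>_. borel)) (\<lambda>\<omega>. restrict (\<lambda>j. ?X j \<omega>) ?J)"
    by (rule indep_var_restrict) auto
  then have "indep_var borel ((\<lambda>f. f i) \<circ> (\<lambda>\<omega>. restrict (\<lambda>j. ?X j \<omega>) {i}))
     borel ((\<lambda>f. \<Sum>k<m. \<delta> * exp (\<Sum>j=Suc i..<Suc i + Suc k. f j)) \<circ> (\<lambda>\<omega>. restrict (\<lambda>j. ?X j \<omega>) ?J))"
  proof (rule indep_var_compose)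
    show "(\<lambda>f. f i) \<in> Pi\<^sub>M {i} (\<lambda>_. borel) \<rightarrow>\<^sub>M borel" by measurable
    have "(\<lambda>f. f j) \<in> Pi\<^sub>M ?J (\<lambda>_. borel) \<rightarrow>\<^sub>M borel" if "j \<in> {Suc i..<Suc i + Suc k}" "k < m" for j k
      using that by (intro measurable_component_singleton) auto
    then show "(\<lambda>f. \<Sum>k<m. \<delta> * exp (\<Sum>j = Suc i..<Suc i + Suc k. f j)) \<in> borel_measurable (Pi\<^sub>M ?J (\<lambda>_. borel))"
      by (intro borel_measurable_sum borel_measurable_times borel_measurable_const borel_measurable_exp[THEN measurable_compose[rotated]]) auto
  qed
  also have "(\<lambda>f. f i) \<circ> (\<lambda>\<omega>. restrict (\<lambda>j. ?X j \<omega>) {i}) = ?X i" by auto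
  also have "(\<lambda>f. \<Sum>k<m. \<delta> * exp (\<Sum>j=Suc i..<Suc i + Suc k. f j)) \<circ> (\<lambda>\<omega>. restrict (\<lambda>j. ?X j \<omega>) ?J)
      = incr_sum B \<delta> m (Suc i)"
  proof
    fix \<omega>
    have "(\<Sum>j=Suc i..<Suc i + Suc k. restrict (\<lambda>j. ?X j \<omega>) ?J j) = B (real (Suc i + Suc k) * \<delta>) \<omega> - B (real (Suc i) * \<delta>) \<omega>"
      if "k < m" for k
    proof -
      have "(\<Sum>j=Suc i..<Suc i + Suc k. restrict (\<lambda>j. ?X j \<omega>) ?J j) = (\<Sum>j=Suc i..<Suc i + Suc k. ?X j \<omega>)"
        using that by (intro sum.cong) auto
      also have "\<dots> = B (real (Suc i + Suc k) * \<delta>) \<omega> - B (real (Suc i) * \<delta>) \<omega>"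
        by (rule sum_Suc_diff') simp
      finally show ?thesis .
    qed
    then show "((\<lambda>f. \<Sum>k<m. \<delta> * exp (\<Sum>j=Suc i..<Suc i + Suc k. f j)) \<circ> (\<lambda>\<omega>. restrict (\<lambda>j. ?X j \<omega>) ?J)) \<omega> = incr_sum B \<delta> m (Suc i) \<omega>"
      unfolding incr_sum_def comp_def by (intro sum.cong) simp_all
  qed
  finally show ?thesis .
qed

lemma (in std_brownian_motion) random_variable_incr_sum [measurable]:
  "\<delta> > 0 \<Longrightarrow> incr_sum B \<delta> m i \<in> borel_measurable M"
  unfolding incr_sum_def[abs_def]
  by (intro borel_measurable_sum borel_measurable_times borel_measurable_const
        borel_measurable_exp[THEN measurable_compose[rotated]] borel_measurable_diff random_variable_at) auto

text \<open>The law is the same for every starting index \<open>i\<close>; this stationarity lets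
  the induction pass from \<open>Suc i\<close> to \<open>i\<close>.\<close>

lemma (in std_brownian_motion) distr_incr_sum:
  assumes "\<delta> > 0"
  shows "distr M borel (incr_sum B \<delta> m i) = chain_law (density lborel (normal_density 0 (sqrt \<delta>))) \<delta> m"
proof (induction m arbitrary: i)
  case 0
  have "distr M borel (incr_sum B \<delta> 0 i) = distr M borel (\<lambda>_. 0)"
    by (intro distr_cong) (auto simp: incr_sum_def)
  then show ?case by (simp add: distr_const)
next
  case (Suc m)
  let ?D = "\<lambda>\<omega>. B (real (Suc i) * \<delta>) \<omega> - B (real i * \<delta>) \<omega>"
  have Dm: "?D \<in> borel_measurable M"
    using assms by (intro borel_measurable_diff random_variable_at) auto
  have D: "distr M borel ?D = density lborel (normal_density 0 (sqrt \<delta>))"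
  proof -
    have "real (Suc i) * \<delta> - real i * \<delta> = \<delta>" by (simp add: algebra_simps)
    then have "distributed M lborel ?D (normal_density 0 (sqrt \<delta>))"
      using gaussian_increments[of "real i * \<delta>" "real (Suc i) * \<delta>"] assms by simp
    then show ?thesis by (auto simp: distributed_def cong: distr_cong)
  qed
  have J: "distr M borel ?D \<Otimes>\<^sub>M distr M borel (incr_sum B \<delta> m (Suc i)) =
        distr M (borel \<Otimes>\<^sub>M borel) (\<lambda>\<omega>. (?D \<omega>, incr_sum B \<delta> m (Suc i) \<omega>))"
    using increments_indep_var[OF assms, of i m] by (simp add: indep_var_distribution_eq)
  have P: "(\<lambda>\<omega>. (?D \<omega>, incr_sum B \<delta> m (Suc i) \<omega>)) \<in> M \<rightarrow>\<^sub>M borel \<Otimes>\<^sub>M borel"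
    using assms by (intro measurable_Pair random_variable_incr_sum Dm)
  have "distr M borel (incr_sum B \<delta> (Suc m) i)
     = distr (distr M (borel \<Otimes>\<^sub>M borel) (\<lambda>\<omega>. (?D \<omega>, incr_sum B \<delta> m (Suc i) \<omega>))) borel (\<lambda>(x, a). exp x * (a + \<delta>))"
    by (subst distr_distr[OF _ P]) (simp_all add: comp_def incr_sum_Suc[abs_def] del: of_nat_Suc)
  also have "\<dots> = chain_law (density lborel (normal_density 0 (sqrt \<delta>))) \<delta> (Suc m)"
    unfolding J[symmetric] D Suc.IH by simp
  finally show ?case .
qed

section \<open>Passage to the limit\<close>

text \<open>If \<open>h x \<le> h y\<close> for some \<open>x < y\<close>, convexity makes
  \<open>h\<close> nondecreasing from \<open>y\<close> on, and the limit \<open>0\<close> forces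
  \<open>h \<le> 0\<close> there, against positivity far out.\<close>

lemma strict_antimono_of_convex:
  fixes h :: "real \<Rightarrow> real"
  assumes conv: "convex_on {a<..} h" and lim: "(h \<longlongrightarrow> 0) at_top"
    and pos: "eventually (\<lambda>x. h x > 0) at_top"
  shows "strict_antimono_on {a<..} h"
proof (rule monotone_onI, rule ccontr)
  have up: "h y \<le> h z" if "a < x" "x < y" "y < z" "h x \<le> h y" for x y z
  proof -
    define s where "s = (y - x) / (z - x)"
    have s: "0 < s" "s < 1" using that by (auto simp: s_def)
    have "(1 - s) *\<^sub>R x + s *\<^sub>R z = x + s * (z - x)" by (simp add: algebra_simps)
    also have "\<dots> = y" using that by (simp add: s_def)
    finally have "h y \<le> (1 - s) * h x + s * h z"
      using convex_onD[OF conv, of s x z] s that by simp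
    also have "\<dots> \<le> (1 - s) * h y + s * h z" using s that by (simp add: mult_left_mono)
    finally have "s * h y \<le> s * h z" by (simp add: algebra_simps)
    then show ?thesis using s by simp
  qed
  fix x y assume xy: "x \<in> {a<..}" "y \<in> {a<..}" "x < y" "\<not> h y < h x"
  have neg: "h z \<le> 0" if "z > y" for z
  proof (rule tendsto_lowerbound[OF lim])
    show "eventually (\<lambda>w. h z \<le> h w) at_top"
      using eventually_gt_at_top[of z]
    proof eventually_elim
      case (elim w)
      then show ?case using up[of x y z] up[of y z w] xy that by auto
    qed
  qed simp
  have "eventually (\<lambda>z. h z > 0 \<and> z > y) at_top"
    using pos eventually_gt_at_top[of y] by (rule eventually_conj)
  then obtain z where "h z > 0" "z > y" using eventually_happens'[OF trivial_limit_at_top_linorder] by blast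
  then show False using neg[of z] by simp
qed

text \<open>Weak convergence gives pointwise limits only outside a countable set. Translating all
  three points of the convexity inequality by the same small \<open>e\<close> preserves their convex
  relation and can avoid that set; right continuity then removes the shift.\<close>

lemma convex_on_limit:
  fixes h :: "real \<Rightarrow> real"
  assumes conv: "eventually (\<lambda>n. convex_on {a<..} (f n)) sequentially"
    and D: "countable D"
    and lim: "\<And>x. x > a \<Longrightarrow> x \<notin> D \<Longrightarrow> (\<lambda>n. f n x) \<longlonglongrightarrow> h x"
    and rc: "\<And>x. x > a \<Longrightarrow> continuous (at_right x) h"
  shows "convex_on {a<..} h"
proof (rule convex_onI)
  fix t x y :: real assume t: "0 < t" "t < 1" and xy: "x \<in> {a<..}" "y \<in> {a<..}"
  define z where "z = (1 - t) *\<^sub>R x + t *\<^sub>R y"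
  have z: "z > a"
    using convexD_alt[of "{a<..}" x y t] xy t by (simp add: z_def)
  \<comment> \<open>The shifts to be avoided: those that move \<open>x\<close>, \<open>y\<close> or
    \<open>z\<close> into \<open>D\<close>.\<close>
  define C where "C = (\<lambda>d. d - x) ` D \<union> (\<lambda>d. d - y) ` D \<union> (\<lambda>d. d - z) ` D"
  have C: "countable C" using D by (simp add: C_def)
  have "\<exists>e. 0 < e \<and> e < inverse (real (Suc k)) \<and> e \<notin> C" for k
  proof -
    have "uncountable ({0<..<inverse (real (Suc k))} - C)"
      using C by (intro uncountable_minus_countable) (simp add: uncountable_open_interval)
    then have "{0<..<inverse (real (Suc k))} - C \<noteq> {}" by (metis countable_empty)
    then show ?thesis by auto
  qed
  then obtain e where e: "\<And>k. 0 < e k" "\<And>k. e k < inverse (real (Suc k))" "\<And>k. e k \<notin> C" by metis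
  have e0: "e \<longlonglongrightarrow> 0"
    by (rule tendsto_sandwich[OF _ _ tendsto_const LIMSEQ_inverse_real_of_nat])
       (use e in \<open>auto intro!: always_eventually less_imp_le\<close>)
  have notD: "x + e k \<notin> D" "y + e k \<notin> D" "z + e k \<notin> D" for k
    using e(3)[of k] by (force simp: C_def image_iff)+
  have ineq: "h (z + e k) \<le> (1 - t) * h (x + e k) + t * h (y + e k)" for k
  proof (rule LIMSEQ_le)
    show "(\<lambda>n. f n (z + e k)) \<longlonglongrightarrow> h (z + e k)"
      using z e(1)[of k] notD by (intro lim) auto
    show "(\<lambda>n. (1 - t) * f n (x + e k) + t * f n (y + e k)) \<longlonglongrightarrow> (1 - t) * h (x + e k) + t * h (y + e k)"
      using xy e(1)[of k] notD by (intro tendsto_intros lim) auto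
    have ze: "z + e k = (1 - t) *\<^sub>R (x + e k) + t *\<^sub>R (y + e k)" by (simp add: z_def algebra_simps)
    have "eventually (\<lambda>n. f n (z + e k) \<le> (1 - t) * f n (x + e k) + t * f n (y + e k)) sequentially"
      using conv unfolding ze
    proof eventually_elim
      case (elim n)
      show ?case by (rule convex_onD[OF elim]) (use t xy e(1)[of k] in auto)
    qed
    then show "\<exists>N. \<forall>n\<ge>N. f n (z + e k) \<le> (1 - t) * f n (x + e k) + t * f n (y + e k)"
      by (simp add: eventually_sequentially)
  qed
  have seq: "(\<lambda>k. h (w + e k)) \<longlonglongrightarrow> h w" if "w > a" for w
  proof (rule filterlim_compose[of h _ "at_right w"])
    show "(h \<longlongrightarrow> h w) (at_right w)" using rc[OF that] by (simp add: continuous_within)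
    have "(\<lambda>k. w + e k) \<longlonglongrightarrow> w + 0" by (intro tendsto_intros e0)
    then show "filterlim (\<lambda>k. w + e k) (at_right w) sequentially"
      using e(1) by (auto simp: filterlim_at intro!: always_eventually)
         (metis less_irrefl)
  qed
  show "h ((1 - t) *\<^sub>R x + t *\<^sub>R y) \<le> (1 - t) * h x + t * h y"
    unfolding z_def[symmetric]
  proof (rule LIMSEQ_le[OF seq[OF z]])
    show "(\<lambda>k. (1 - t) * h (x + e k) + t * h (y + e k)) \<longlonglongrightarrow> (1 - t) * h x + t * h y"
      using xy by (intro tendsto_intros seq) auto
  qed (use ineq in blast)
qed simp

text \<open>The weight equals \<open>a + \<delta> n\<close> times an exponential whose exponent is
  -2 times the difference quotient of \<open>ln\<close> at \<open>a\<close>, and the quotient tends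
  to \<open>1 / a\<close>.\<close>

lemma weight_tendsto:
  fixes a :: real
  assumes a: "a > 0" and \<delta>: "\<And>n. \<delta> n > 0" "\<delta> \<longlonglongrightarrow> 0"
  shows "(\<lambda>n. weight (2 / \<delta> n) (\<delta> n) a) \<longlonglongrightarrow> a * exp (- 2 / a)"
proof -
  have "((\<lambda>h. (ln (a + h) - ln a) / h) \<longlongrightarrow> 1 / a) (at 0)"
    using DERIV_ln_divide[OF a] by (simp add: DERIV_def)
  moreover have "filterlim \<delta> (at 0) sequentially"
    using \<delta>(2) less_imp_neq[OF \<delta>(1)] by (auto simp: filterlim_at)
  ultimately have L: "(\<lambda>n. (ln (a + \<delta> n) - ln a) / \<delta> n) \<longlonglongrightarrow> 1 / a"
    by (rule filterlim_compose)
  then have "(\<lambda>n. (a + \<delta> n) * exp (- 2 * ((ln (a + \<delta> n) - ln a) / \<delta> n))) \<longlonglongrightarrow> (a + 0) * exp (- 2 * (1 / a))"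
    by (intro tendsto_mult tendsto_add tendsto_exp tendsto_const \<delta>(2) L)
  moreover have "(a + \<delta> n) * exp (- 2 * ((ln (a + \<delta> n) - ln a) / \<delta> n)) = weight (2 / \<delta> n) (\<delta> n) a" for n
  proof -
    have ad: "a + \<delta> n > 0" using a \<delta>(1)[of n] by simp
    have "weight (2 / \<delta> n) (\<delta> n) a = (a + \<delta> n) * (exp (2 / \<delta> n * ln a) / exp (2 / \<delta> n * ln (a + \<delta> n)))"
      using a ad by (simp add: weight_def powr_diff) (simp add: powr_def)
    also have "exp (2 / \<delta> n * ln a) / exp (2 / \<delta> n * ln (a + \<delta> n)) = exp (- 2 * ((ln (a + \<delta> n) - ln a) / \<delta> n))"
      unfolding exp_diff[symmetric] by (simp add: diff_divide_distrib right_diff_distrib)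
    finally show ?thesis by simp
  qed
  ultimately show ?thesis by simp
qed

section \<open>Normal and Beta steps satisfy the replacement hypotheses\<close>

lemma step_law_normal:
  assumes "\<delta> > 0" "K \<ge> 3"
  shows "step_law K \<delta> (density lborel (normal_density 0 (sqrt \<delta>)))"
proof -
  let ?N = "normal_density 0 (sqrt \<delta>)"
  have s: "sqrt \<delta> > 0" using assms by simp
  have [simp]: "integrable (density lborel ?N) (\<lambda>x. x ^ k)" for k
    using integrable_normal_moment[OF s, of 0 k] by (simp add: integrable_density)
  have m2: "(LINT x|density lborel ?N. x ^ 2) = \<delta>"
    using integral_normal_moment_even[OF s, of 0 1] assms by (simp add: integral_density)
  have m4: "(LINT x|density lborel ?N. x ^ 4) = 3 * \<delta>\<^sup>2"
    using integral_normal_moment_even[OF s, of 0 2] assms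
    by (simp add: integral_density fact_numeral power2_eq_square field_simps)
  have m1: "(LINT x|density lborel ?N. x) = 0"
    using integral_normal_moment_odd[OF s, of 0 0] by (simp add: integral_density)
  show ?thesis
    unfolding step_law_def m1 m2 m4
    using assms s by (auto intro!: prob_space_normal_density mult_right_mono)
qed

text \<open>The choice \<open>p = 2 / \<delta>\<close> makes both variance bounds agree with
  \<open>\<delta>\<close> up to \<open>\<delta>\<^sup>2\<close>. The constant 8 comes from the
  fourth moment: for \<open>\<delta> \<le> 1 / 2\<close> its bound is at most
  \<open>12 * \<delta>\<^sup>2 / (3 / 2)\<close>.\<close>

lemma step_law_logit_beta:
  assumes "0 < \<delta>" "\<delta> \<le> 1 / 2" "K \<ge> 8"
  shows "step_law K \<delta> (logit_beta (2 / \<delta>))"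
proof -
  define p where "p = 2 / \<delta>"
  have p: "p > 2" using assms by (simp add: p_def field_simps)
  note m = logit_beta_moments[OF p]
  have K: "8 * \<delta>\<^sup>2 \<le> K * \<delta>\<^sup>2" using assms by (intro mult_right_mono) auto
  have "2 / (p - 1) - \<delta> = \<delta>\<^sup>2 / (2 - \<delta>)"
    using assms by (simp add: p_def field_simps power2_eq_square)
  also have "\<dots> \<le> \<delta>\<^sup>2 / 1" using assms by (intro divide_left_mono) auto
  finally have u: "2 / (p - 1) - \<delta> \<le> 8 * \<delta>\<^sup>2"
    using zero_le_power2[of \<delta>] by linarith
  have "\<delta> - 4 / (2 * p + 1) = \<delta>\<^sup>2 / (4 + \<delta>)"
    using assms by (simp add: p_def field_simps power2_eq_square)
  also have "\<dots> \<le> \<delta>\<^sup>2 / 1" using assms by (intro divide_left_mono) auto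
  finally have l: "\<delta> - 4 / (2 * p + 1) \<le> 8 * \<delta>\<^sup>2"
    using zero_le_power2[of \<delta>] by linarith
  have "12 / ((p - 1) * (p - 2)) = 12 * \<delta>\<^sup>2 / ((2 - \<delta>) * (2 - 2 * \<delta>))"
    using assms by (simp add: p_def divide_simps power2_eq_square)
  also have "\<dots> \<le> 12 * \<delta>\<^sup>2 / (3 / 2 * 1)"
    using assms by (intro divide_left_mono mult_mono) auto
  finally have q: "12 / ((p - 1) * (p - 2)) \<le> 8 * \<delta>\<^sup>2" by simp
  show ?thesis
    unfolding step_law_def p_def[symmetric]
    using p m K u l q by (auto intro!: prob_space_logit_beta)
qed

text \<open>Writing the sine as a cosine shifted by \<open>pi / 2\<close> lets the cosine estimates
  with a free phase \<open>\<eta>\<close> cover both the real and the imaginary part.\<close>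

lemma char_distr_eq:
  assumes "prob_space M" and [measurable]: "X \<in> borel_measurable M"
  shows "char (distr M borel X) \<theta> =
    Complex (LINT \<omega>|M. cos (\<theta> * X \<omega> + 0)) (LINT \<omega>|M. cos (\<theta> * X \<omega> + - (pi / 2)))"
proof -
  interpret prob_space M by fact
  have i: "complex_integrable M (\<lambda>\<omega>. iexp (\<theta> * X \<omega>))"
    by (intro integrable_const_bound[where B = 1]) auto
  have "char (distr M borel X) \<theta> = (CLINT \<omega>|M. iexp (\<theta> * X \<omega>))"
    unfolding char_def by (subst integral_distr) auto
  moreover have "Re (CLINT \<omega>|M. iexp (\<theta> * X \<omega>)) = (LINT \<omega>|M. cos (\<theta> * X \<omega> + 0))"
    using integral_Re[OF i] by (simp add: Re_exp)
  moreover have "Im (CLINT \<omega>|M. iexp (\<theta> * X \<omega>)) = (LINT \<omega>|M. cos (\<theta> * X \<omega> + - (pi / 2)))"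
    using integral_Im[OF i] by (simp add: Im_exp cos_diff)
  ultimately show ?thesis by (simp add: complex_eq_iff)
qed


text \<open>Translates convergence in law of the logarithms back to distribution functions of the
  variables themselves. Positivity is essential, as \<open>ln\<close> has no meaningful value at
  other arguments.\<close>

lemma cdf_ln_eq:
  assumes "prob_space N" and [measurable]: "X \<in> borel_measurable N" and "AE \<omega> in N. X \<omega> > 0"
  shows "cdf (distr N borel (\<lambda>\<omega>. ln (X \<omega>))) y = measure N {\<omega> \<in> space N. X \<omega> \<le> exp y}"
proof -
  interpret N: prob_space N by fact
  have "cdf (distr N borel (\<lambda>\<omega>. ln (X \<omega>))) y = measure N {\<omega> \<in> space N. ln (X \<omega>) \<le> y}"
    unfolding cdf_def by (subst measure_distr) (auto intro!: arg_cong[where f = "measure N"])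
  also have "\<dots> = measure N {\<omega> \<in> space N. X \<omega> \<le> exp y}"
  proof (rule N.finite_measure_eq_AE)
    show "AE \<omega> in N. (\<omega> \<in> {\<omega> \<in> space N. ln (X \<omega>) \<le> y}) = (\<omega> \<in> {\<omega> \<in> space N. X \<omega> \<le> exp y})"
      using assms(3)
    proof eventually_elim
      case (elim \<omega>)
      then have "ln (X \<omega>) \<le> y \<longleftrightarrow> X \<omega> \<le> exp y" by (metis exp_le_cancel_iff exp_ln)
      then show ?case by simp
    qed
  qed measurable
  finally show ?thesis .
qed

section \<open>Convergence of the Beta chain to the exponential functional\<close>

context std_brownian_motion
begin

lemma continuous_on_exp_path:
  "\<omega> \<in> space M \<Longrightarrow> continuous_on {0..t} (\<lambda>s. exp (B s \<omega>))"
  by (rule continuous_on_exp, rule continuous_on_subset[OF continuous_paths]) auto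

lemma exp_functional_riemann:
  assumes "t > 0" "\<omega> \<in> space M"
  shows "(\<lambda>n. \<Sum>k<Suc n. t / real (Suc n) * exp (B (real (Suc k) * (t / real (Suc n))) \<omega>)) \<longlonglongrightarrow> exp_functional B t \<omega>"
  unfolding exp_functional_def
  by (intro riemann_sum_tendsto continuous_on_exp_path assms)

lemma borel_measurable_exp_functional:
  assumes "t > 0"
  shows "exp_functional B t \<in> borel_measurable M"
proof (rule borel_measurable_LIMSEQ_real[OF exp_functional_riemann[OF assms]])
  show "(\<lambda>\<omega>. \<Sum>k<Suc n. t / real (Suc n) * exp (B (real (Suc k) * (t / real (Suc n))) \<omega>)) \<in> borel_measurable M" for n
    using assms
    by (intro borel_measurable_sum borel_measurable_times borel_measurable_const
        borel_measurable_exp[THEN measurable_compose[rotated]] random_variable_at) auto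
qed

lemma exp_functional_pos:
  assumes "t > 0" "\<omega> \<in> space M"
  shows "exp_functional B t \<omega> > 0"
proof -
  let ?f = "\<lambda>s. exp (B s \<omega>)"
  have c: "continuous_on {0..t} ?f"
    by (rule continuous_on_exp_path[OF assms(2)])
  obtain x where x: "x \<in> {0..t}" "\<And>y. y \<in> {0..t} \<Longrightarrow> ?f x \<le> ?f y"
    using continuous_attains_inf[OF _ _ c] assms(1) by auto
  have "0 < t * ?f x" using assms(1) by simp
  also have "\<dots> \<le> integral {0..t} ?f"
    using integral_le[OF integrable_continuous_real[OF continuous_on_const] integrable_continuous_real[OF c], of "?f x"] x assms(1) by simp
  finally show ?thesis by (simp add: exp_functional_def)
qed

lemma AE_incr_sum_tendsto:
  assumes "t > 0"
  shows "AE \<omega> in M. (\<lambda>n. incr_sum B (t / real (Suc n)) (Suc n) 0 \<omega>) \<longlonglongrightarrow> exp_functional B t \<omega>"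
  using starts_at_0 AE_space
proof eventually_elim
  case (elim \<omega>)
  then show ?case
    using exp_functional_riemann[OF assms, of \<omega>] by (simp add: incr_sum_def)
qed

text \<open>The Gaussian chain serves as intermediary. It has the law of a Riemann sum along the
  path, so dominated convergence gives its limit; the Beta chain differs from it by
  \<open>Suc n\<close> errors of order \<open>\<delta> n * sqrt (\<delta> n)\<close>, in total of
  order \<open>t * sqrt (\<delta> n)\<close>.\<close>

lemma chain_law_cos_tendsto:
  assumes t: "t > 0"
  defines "\<delta> \<equiv> \<lambda>n. t / real (Suc n)"
  shows "(\<lambda>n. LINT a|chain_law (logit_beta (2 / \<delta> n)) (\<delta> n) (Suc n). cos (\<theta> * ln a + \<eta>))
     \<longlonglongrightarrow> (LINT \<omega>|M. cos (\<theta> * ln (exp_functional B t \<omega>) + \<eta>))"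
proof -
  let ?N = "\<lambda>n. density lborel (normal_density 0 (sqrt (\<delta> n)))"
  have \<delta>: "\<delta> n > 0" for n using t by (simp add: \<delta>_def)
  note [measurable] = borel_measurable_exp_functional[OF t] random_variable_incr_sum[OF \<delta>]
  have \<delta>0: "\<delta> \<longlonglongrightarrow> 0"
    unfolding \<delta>_def using LIMSEQ_Suc[OF lim_const_over_n[of t]] by simp
  have "(\<lambda>n. LINT \<omega>|M. cos (\<theta> * ln (incr_sum B (\<delta> n) (Suc n) 0 \<omega>) + \<eta>))
     \<longlonglongrightarrow> (LINT \<omega>|M. cos (\<theta> * ln (exp_functional B t \<omega>) + \<eta>))"
  proof (rule integral_dominated_convergence[where w = "\<lambda>_. 1"])
    show "AE \<omega> in M. (\<lambda>n. cos (\<theta> * ln (incr_sum B (\<delta> n) (Suc n) 0 \<omega>) + \<eta>)) \<longlonglongrightarrow> cos (\<theta> * ln (exp_functional B t \<omega>) + \<eta>)"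
      using AE_incr_sum_tendsto[OF t] AE_space
    proof eventually_elim
      case (elim \<omega>)
      then show ?case
        using exp_functional_pos[OF t, of \<omega>] unfolding \<delta>_def by (intro tendsto_intros) auto
    qed
  qed (use \<delta> in auto)
  moreover have "(LINT \<omega>|M. cos (\<theta> * ln (incr_sum B (\<delta> n) (Suc n) 0 \<omega>) + \<eta>)) = (LINT a|chain_law (?N n) (\<delta> n) (Suc n). cos (\<theta> * ln a + \<eta>))" for n
    unfolding distr_incr_sum[OF \<delta>, of n "Suc n" 0, symmetric] by (subst integral_distr) auto
  ultimately have lim: "(\<lambda>n. LINT a|chain_law (?N n) (\<delta> n) (Suc n). cos (\<theta> * ln a + \<eta>))
     \<longlonglongrightarrow> (LINT \<omega>|M. cos (\<theta> * ln (exp_functional B t \<omega>) + \<eta>))" by simp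
  \<comment> \<open>The replacement constant for \<open>K = 8\<close>, a value admissible for both
    the normal and the Beta steps.\<close>
  let ?C = "2 * (\<bar>\<theta>\<bar> + 3 * \<theta>\<^sup>2 + \<bar>\<theta>\<bar> ^ 3) * (1 + 2 * 8)"
  have "(\<lambda>n. (LINT a|chain_law (logit_beta (2 / \<delta> n)) (\<delta> n) (Suc n). cos (\<theta> * ln a + \<eta>)) -
      (LINT a|chain_law (?N n) (\<delta> n) (Suc n). cos (\<theta> * ln a + \<eta>))) \<longlonglongrightarrow> 0"
  proof (rule tendsto_0_le[where K = 1])
    have "(\<lambda>n. ?C * t * sqrt (\<delta> n)) \<longlonglongrightarrow> ?C * t * sqrt 0"
      by (intro tendsto_mult tendsto_const tendsto_real_sqrt \<delta>0)
    then show "(\<lambda>n. ?C * t * sqrt (\<delta> n)) \<longlonglongrightarrow> 0" by simp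
    have "eventually (\<lambda>n. \<delta> n < 1 / 2) sequentially"
      using \<delta>0 by (rule order_tendstoD) simp
    then show "eventually (\<lambda>n. norm ((LINT a|chain_law (logit_beta (2 / \<delta> n)) (\<delta> n) (Suc n). cos (\<theta> * ln a + \<eta>)) -
      (LINT a|chain_law (?N n) (\<delta> n) (Suc n). cos (\<theta> * ln a + \<eta>))) \<le> norm (?C * t * sqrt (\<delta> n)) * 1) sequentially"
    proof eventually_elim
      case (elim n)
      \<comment> \<open>The form \<open>0 + 1 * a\<close> presents the logarithm as the case
        \<open>c = 0\<close>, \<open>d = 1\<close> of the replacement lemma.\<close>
      have "\<bar>(LINT a|chain_law (logit_beta (2 / \<delta> n)) (\<delta> n) (Suc n). cos (\<theta> * ln (0 + 1 * a) + \<eta>)) -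
          (LINT a|chain_law (?N n) (\<delta> n) (Suc n). cos (\<theta> * ln (0 + 1 * a) + \<eta>))\<bar>
        \<le> real (Suc n) * (?C * (\<delta> n * sqrt (\<delta> n)))"
        using elim \<delta>[of n] by (intro chain_law_replacement step_law_logit_beta step_law_normal) auto
      also have "\<dots> = ?C * (real (Suc n) * \<delta> n) * sqrt (\<delta> n)" by (simp only: mult_ac)
      also have "real (Suc n) * \<delta> n = t" by (simp add: \<delta>_def del: of_nat_Suc)
      finally show ?case by simp
    qed
  qed
  from tendsto_add[OF this lim] show ?thesis by simp
qed

text \<open>Convergence is stated for logarithms because the replacement estimate controls exactly
  the cosines of \<open>\<theta> * ln a + \<eta>\<close>, that is, the characteristic function of
  the logarithm.\<close>

lemma chain_law_weak_conv:
  assumes t: "t > 0"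
  defines "\<delta> \<equiv> \<lambda>n. t / real (Suc n)"
  shows "weak_conv_m (\<lambda>n. distr (chain_law (logit_beta (2 / \<delta> n)) (\<delta> n) (Suc n)) borel ln)
     (distr M borel (\<lambda>\<omega>. ln (exp_functional B t \<omega>)))"
proof (rule levy_continuity)
  have \<delta>: "\<delta> n > 0" for n using t by (simp add: \<delta>_def)
  have p: "prob_space (chain_law (logit_beta (2 / \<delta> n)) (\<delta> n) (Suc n))" for n
    using \<delta>[of n] by (intro prob_space_chain_law prob_space_logit_beta) auto
  note [measurable] = borel_measurable_exp_functional[OF t]
  show "real_distribution (distr (chain_law (logit_beta (2 / \<delta> n)) (\<delta> n) (Suc n)) borel ln)" for n
    by (intro prob_space.real_distribution_distr p) measurable
  show "real_distribution (distr M borel (\<lambda>\<omega>. ln (exp_functional B t \<omega>)))"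
    by (intro real_distribution_distr) measurable
  fix \<theta>
  have "(\<lambda>n. char (distr (chain_law (logit_beta (2 / \<delta> n)) (\<delta> n) (Suc n)) borel ln) \<theta>) =
    (\<lambda>n. Complex (LINT a|chain_law (logit_beta (2 / \<delta> n)) (\<delta> n) (Suc n). cos (\<theta> * ln a + 0))
         (LINT a|chain_law (logit_beta (2 / \<delta> n)) (\<delta> n) (Suc n). cos (\<theta> * ln a + - (pi / 2))))"
    by (intro ext char_distr_eq p) measurable
  moreover have "char (distr M borel (\<lambda>\<omega>. ln (exp_functional B t \<omega>))) \<theta> =
    Complex (LINT \<omega>|M. cos (\<theta> * ln (exp_functional B t \<omega>) + 0)) (LINT \<omega>|M. cos (\<theta> * ln (exp_functional B t \<omega>) + - (pi / 2)))"
    by (intro char_distr_eq prob_space_axioms) measurable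
  ultimately show "(\<lambda>n. char (distr (chain_law (logit_beta (2 / \<delta> n)) (\<delta> n) (Suc n)) borel ln) \<theta>)
      \<longlonglongrightarrow> char (distr M borel (\<lambda>\<omega>. ln (exp_functional B t \<omega>))) \<theta>"
    using chain_law_cos_tendsto[OF t] unfolding \<delta>_def by (simp only: tendsto_Complex)
qed

end

theorem corollary5p3:
  fixes M :: "'a measure" and B :: "real \<Rightarrow> 'a \<Rightarrow> real" and t :: real
  assumes "std_brownian_motion M B"
    and "t > 0"
  shows "strict_antimono_on {0<..}
           (\<lambda>a :: real. exp (2 / a) / a * \<P>(\<omega> in M. exp_functional B t \<omega> \<le> a))"
proof -
  interpret std_brownian_motion M B by fact
  note t = \<open>t > 0\<close>
  note [measurable] = borel_measurable_exp_functional[OF t]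
  define \<mu> where "\<mu> = distr M borel (\<lambda>\<omega>. ln (exp_functional B t \<omega>))"
  interpret \<mu>: real_distribution \<mu>
    unfolding \<mu>_def by (intro real_distribution_distr) measurable
  define F where "F a = \<P>(\<omega> in M. exp_functional B t \<omega> \<le> a)" for a
  define h where "h a = exp (2 / a) / a * F a" for a
  have F_cdf: "F a = cdf \<mu> (ln a)" if "a > 0" for a
    using cdf_ln_eq[OF prob_space_axioms, of "exp_functional B t" "ln a"] exp_functional_pos[OF t] that
    by (auto simp: \<mu>_def F_def intro!: AE_I2)
  define \<delta> where "\<delta> n = t / real (Suc n)" for n
  define f where "f n a = measure (chain_law (logit_beta (2 / \<delta> n)) (\<delta> n) (Suc n)) {..a} / weight (2 / \<delta> n) (\<delta> n) a" for n a
  have \<delta>: "\<delta> n > 0" for n using t by (simp add: \<delta>_def)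
  have \<delta>0: "\<delta> \<longlonglongrightarrow> 0"
    unfolding \<delta>_def using LIMSEQ_Suc[OF lim_const_over_n[of t]] by simp
  have "convex_on {0<..} h"
  proof (rule convex_on_limit)
    \<comment> \<open>A mesh below \<open>1\<close> gives \<open>2 / \<delta> n \<ge> 1\<close>, as
      the convexity lemma for the chain demands.\<close>
    have "eventually (\<lambda>n. \<delta> n < 1) sequentially"
      using \<delta>0 by (rule order_tendstoD) simp
    then show "eventually (\<lambda>n. convex_on {0<..} (f n)) sequentially"
    proof eventually_elim
      case (elim n)
      then show ?case unfolding f_def using \<delta>[of n] by (intro convex_chain_law_ratio) auto
    qed
    \<comment> \<open>The exceptional set consists of the discontinuities of the monotone function
      \<open>cdf \<mu>\<close>, carried from the logarithmic scale back to the original one.\<close>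
    show "countable (exp ` {y. \<not> isCont (cdf \<mu>) y})"
      by (intro countable_image mono_ctble_discont monoI \<mu>.cdf_nondecreasing)
    fix a :: real assume a: "a > 0"
    \<comment> \<open>As \<open>ln\<close> is strictly increasing, approaching \<open>a\<close> from
      the right means approaching \<open>ln a\<close> from the right, so right continuity of the
      distribution function carries over.\<close>
    have "continuous (at_right a) (\<lambda>a. cdf \<mu> (ln a))"
      unfolding continuous_within
    proof (rule filterlim_compose[of "cdf \<mu>" _ "at_right (ln a)"])
      show "(cdf \<mu> \<longlongrightarrow> cdf \<mu> (ln a)) (at_right (ln a))"
        using \<mu>.cdf_is_right_cont by (simp add: continuous_within)
      have "(ln \<longlongrightarrow> ln a) (at_right a)" using a by (intro tendsto_intros) auto
      moreover have "eventually (\<lambda>x. x > a) (at_right a)" by (simp add: eventually_at_right_less)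
      then have "eventually (\<lambda>x. ln x \<in> {ln a<..} \<and> ln x \<noteq> ln a) (at_right a)"
        by eventually_elim (use a in auto)
      ultimately show "filterlim ln (at_right (ln a)) (at_right a)"
        by (simp add: filterlim_at)
    qed
    then have "continuous (at_right a) (\<lambda>a. exp (2 / a) / a * cdf \<mu> (ln a))"
      using a by (intro continuous_intros) auto
    then show "continuous (at_right a) h"
      unfolding continuous_within using a
    proof (rule_tac Lim_transform_eventually)
      assume "((\<lambda>a. exp (2 / a) / a * cdf \<mu> (ln a)) \<longlongrightarrow> exp (2 / a) / a * cdf \<mu> (ln a)) (at_right a)"
      then show "((\<lambda>a. exp (2 / a) / a * cdf \<mu> (ln a)) \<longlongrightarrow> h a) (at_right a)"
        using a by (simp add: h_def F_cdf)
      have "eventually (\<lambda>x. x > a) (at_right a)" by (simp add: eventually_at_right_less)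
      then show "eventually (\<lambda>x. exp (2 / x) / x * cdf \<mu> (ln x) = h x) (at_right a)"
        by eventually_elim (use a in \<open>simp add: h_def F_cdf\<close>)
    qed
    assume "a \<notin> exp ` {y. \<not> isCont (cdf \<mu>) y}"
    then have "isCont (cdf \<mu>) (ln a)" using a by (metis (mono_tags, lifting) exp_ln image_eqI mem_Collect_eq)
    then have "(\<lambda>n. cdf (distr (chain_law (logit_beta (2 / \<delta> n)) (\<delta> n) (Suc n)) borel ln) (ln a)) \<longlonglongrightarrow> cdf \<mu> (ln a)"
      using chain_law_weak_conv[OF t] unfolding \<mu>_def \<delta>_def weak_conv_m_def weak_conv_def by blast
    moreover have "cdf (distr (chain_law (logit_beta (2 / \<delta> n)) (\<delta> n) (Suc n)) borel ln) (ln a)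
        = measure (chain_law (logit_beta (2 / \<delta> n)) (\<delta> n) (Suc n)) {..a}" for n
    proof -
      have b: "prob_space (logit_beta (2 / \<delta> n))" using \<delta>[of n] by (intro prob_space_logit_beta) simp
      have "AE x in chain_law (logit_beta (2 / \<delta> n)) (\<delta> n) (Suc n). x > 0"
        by (intro AE_chain_law_nonneg(2) b \<delta>) auto
      then show ?thesis
        using cdf_ln_eq[OF prob_space_chain_law[OF b], of "\<lambda>x. x" "\<delta> n" "Suc n" "ln a"] a
        by (simp add: atMost_def del: chain_law.simps)
    qed
    ultimately have "(\<lambda>n. f n a) \<longlonglongrightarrow> cdf \<mu> (ln a) / (a * exp (- 2 / a))"
      unfolding f_def using a by (intro tendsto_divide weight_tendsto \<delta> \<delta>0) auto
    also have "cdf \<mu> (ln a) / (a * exp (- 2 / a)) = h a"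
      using a by (simp add: h_def F_cdf exp_minus field_simps)
    finally show "(\<lambda>n. f n a) \<longlonglongrightarrow> h a" .
  qed
  moreover have F1: "(F \<longlongrightarrow> 1) at_top"
  proof -
    have "((\<lambda>a. cdf \<mu> (ln a)) \<longlongrightarrow> 1) at_top"
      by (rule filterlim_compose[OF \<mu>.cdf_lim_at_top_prob ln_at_top])
    then show ?thesis
      by (rule tendsto_cong[THEN iffD1, rotated])
         (use F_cdf in \<open>auto intro: eventually_mono[OF eventually_gt_at_top[of 0]]\<close>)
  qed
  \<comment> \<open>In terms of \<open>inverse a\<close> each factor has a limit at infinity;
    \<open>h\<close> decays like \<open>1 / a\<close>.\<close>
  have "((\<lambda>a. exp (2 * inverse a) * inverse a * F a) \<longlongrightarrow> exp (2 * 0) * 0 * 1) at_top"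
    by (intro tendsto_intros F1 tendsto_inverse_0_at_top filterlim_ident)
  then have "(h \<longlongrightarrow> 0) at_top" by (simp add: h_def[abs_def] field_simps)
  moreover have "eventually (\<lambda>a. h a > 0) at_top"
    using order_tendstoD(1)[OF F1 zero_less_one] eventually_gt_at_top[of 0]
    by eventually_elim (simp add: h_def)
  ultimately have "strict_antimono_on {0<..} h"
    by (rule strict_antimono_of_convex)
  then show ?thesis by (simp add: h_def[abs_def] F_def)
qed

end
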